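(* As formal series in $Z^{-1}$, $$\sum_{n\ge1}g_n\,Z^{-n}=\frac1{16}\,\psi'\!\Bigl(\frac{Z+1}4\Bigr)-\frac1{16}\,\psi'\!\Bigl(\frac{Z+3}4\Bigr)+\frac14\,\psi'\!\Bigl(\frac{Z+1}2\Bigr)-\frac i2\,\widehat Q_\Gamma(Z),$$ where each $\psi'$ stands for its Bernoulli asymptotic expansion and $\widehat Q_\Gamma(Z)$ is the series $\widehat Q_\Gamma$ of the context rewritten in powers of $Z^{-1}$. In particular, writing $\widehat Q_\Gamma=\sum_{n\ge1}\widehat q_nZ^{-n}$, $$\operatorname{Im}g_n=-\tfrac12\,\widehat q_n\qquad(n\ge1).$$
   Context: Definition of $g_n$. For $\nu$ and $k\ge0$ let $a_k(\nu)=\dfrac{\prod_{j=0}^{k-1}(4\nu^2-(2j+1)^2)}{8^k k!}$. Let $p=1+i$, $q=1-i$, $A=\alpha^2$, $B=\beta^2$, $G_n=\sum_{l=0}^n a_l(\alpha)a_{n-l}(\beta)p^lq^{n-l}$ and $F(Z)=\sum_{n\ge0}\dfrac{G_n}{(Z-1)\cdots(Z-n)}$, a formal power series in $Z^{-1}$ (each summand expanded at $Z=\infty$) with constant term $1$. Write $\log F=\sum_{n\ge1}L_nZ^{-n}$ (each $L_n$ a polynomial in $A,B$ over $\mathbb Q(i)$) and $g_n=\partial_AL_n|_{A=B=0}$. The Bernoulli asymptotic expansion of the trigamma function is $\psi'(x)\sim x^{-1}+\frac12x^{-2}+\sum_{k\ge1}B_{2k}x^{-2k-1}$; with $x$ affine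 in $Z$ it is re-expanded in powers of $Z^{-1}$. Definition of $\widehat Q_\Gamma$. With Bernoulli polynomials $B_k(x)$, let $$\widehat{\mathsf r}(s)=2\exp\Bigl(2\sum_{n\ge1}\frac{(-1)^{n+1}[B_{n+1}(0)-B_{n+1}(\frac12)]}{n(n+1)}\Bigl(\frac2s\Bigr)^n\Bigr)\in 2+s^{-1}\mathbb Q[[s^{-1}]],$$ $$\widehat{\mathsf f}_\Gamma(s)=-\frac{(2s-1)\,\widehat{\mathsf r}(s)}{4s^2(s-1)}\in s^{-2}\mathbb Q[[s^{-1}]].$$ $\widehat Q_\Gamma\in s^{-1}\mathbb Q[[s^{-1}]]$ is the unique formal solution of $\widehat Q_\Gamma(s+1)-\widehat Q_\Gamma(s-1)=\widehat{\mathsf f}_\Gamma(s)$ (equivalently $\widehat Q_\Gamma=\frac1{2\sinh D}\widehat{\mathsf f}_\Gamma$ with $D=d/ds$). It is rewritten in $Z^{-1}$ by the substitution $s=(1-Z)/2$. *)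

theory Defs
  imports "HOL-Analysis.Analysis" "HOL-Computational_Algebra.Computational_Algebra"
begin

unbundle no vec_syntax

text \<open>
  A formal series in negative powers of a variable (\<open>Z\<close>, \<open>s\<close> or \<open>x\<close>) is encoded as a formal power
  series whose indeterminate \<^const>\<open>fps_X\<close> stands for the reciprocal of that variable.
\<close>

text \<open>
  The expansion at infinity of \<open>1 / (a Z + b)\<close>, for \<open>a \<noteq> 0\<close>. Substituting \<open>a Z + b\<close> for the
  variable of a series is composition with it.
\<close>
definition recip_affine :: "'a::field \<Rightarrow> 'a \<Rightarrow> 'a fps" where
  "recip_affine a b = fps_X * inverse (fps_const a + fps_const b * fps_X)"


subsection \<open>The coefficients \<open>g\<^sub>n\<close>\<close>

text \<open>\<open>a\<^sub>k(\<nu>)\<close> depends on \<open>\<nu>\<close> only through \<open>\<nu>\<^sup>2\<close>; the argument \<open>N\<close> is \<open>\<nu>\<^sup>2\<close>.\<close>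
definition acoeff :: "nat \<Rightarrow> complex \<Rightarrow> complex" where
  "acoeff k N = (\<Prod>j<k. 4 * N - (2 * of_nat j + 1)\<^sup>2) / (8 ^ k * fact k)"

definition Gcoeff :: "nat \<Rightarrow> complex \<Rightarrow> complex \<Rightarrow> complex" where
  "Gcoeff n A B =
     (\<Sum>l\<le>n. acoeff l A * acoeff (n - l) B * (1 + \<i>) ^ l * (1 - \<i>) ^ (n - l))"

text \<open>
  The \<open>n\<close>-th summand of \<open>F\<close> is divisible by \<open>fps_X ^ n\<close>, so only the summands with \<open>n \<le> m\<close>
  contribute to the coefficient of \<open>Z\<^sup>-\<^sup>m\<close>.
\<close>
definition Fseries :: "complex \<Rightarrow> complex \<Rightarrow> complex fps" where
  "Fseries A B = Abs_fps (\<lambda>m.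
     (\<Sum>n\<le>m. fps_const (Gcoeff n A B) * (\<Prod>j=1..n. recip_affine 1 (- of_nat j))) $ m)"

text \<open>\<^term>\<open>fps_ln 1\<close> is the series of \<open>log (1 + X)\<close>.\<close>
definition logF :: "complex \<Rightarrow> complex \<Rightarrow> complex fps" where
  "logF A B = fps_ln 1 oo (Fseries A B - 1)"

definition Lcoeff :: "nat \<Rightarrow> complex \<Rightarrow> complex \<Rightarrow> complex" where
  "Lcoeff n A B = logF A B $ n"

text \<open>
  \<^term>\<open>Lcoeff n\<close> is a polynomial function (lemma \<open>Lcoeff_polynomial\<close> below), so the complex
  derivative here is the formal partial derivative of the polynomial \<open>L\<^sub>n\<close>.
\<close>
definition g :: "nat \<Rightarrow> complex" where
  "g n = deriv (\<lambda>A. Lcoeff n A 0) 0"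


subsection \<open>Bernoulli polynomials and the trigamma expansion\<close>

text \<open>
  \<open>t exp (x t) / (exp t - 1) = \<Sum>\<^sub>n B\<^sub>n(x) t\<^sup>n / n!\<close>; the Bernoulli number \<open>B\<^sub>n\<close> is \<open>B\<^sub>n(0)\<close>.
\<close>
definition bernoulli_poly :: "nat \<Rightarrow> 'a::field_char_0 \<Rightarrow> 'a" where
  "bernoulli_poly n x = fact n * ((fps_X * fps_exp x) / (fps_exp 1 - 1)) $ n"

text \<open>
  The asymptotic series of \<open>\<psi>'(x)\<close> in \<open>1 / x\<close>; an odd exponent \<open>m \<ge> 3\<close> is \<open>2 k + 1\<close> with
  \<open>2 k = m - 1\<close>.
\<close>
definition trigamma_series :: "complex fps" where
  "trigamma_series = Abs_fps (\<lambda>m.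
     if m = 1 then 1
     else if m = 2 then 1 / 2
     else if odd m then bernoulli_poly (m - 1) 0
     else 0)"


subsection \<open>The series \<open>Q\<^sub>\<Gamma>\<close>\<close>

definition rhat :: "rat fps" where
  "rhat = 2 * (fps_exp 1 oo (2 * Abs_fps (\<lambda>n.
     if n = 0 then 0
     else (- 1) ^ (n + 1) * (bernoulli_poly (n + 1) 0 - bernoulli_poly (n + 1) (1 / 2))
            / (of_nat n * of_nat (n + 1)) * 2 ^ n)))"

text \<open>With \<open>Y = 1 / s\<close>, \<open>(2 s - 1) / (4 s\<^sup>2 (s - 1)) = Y\<^sup>2 (2 - Y) / (4 (1 - Y))\<close>.\<close>
definition fhat :: "rat fps" where
  "fhat = - (fps_X\<^sup>2 * (2 - fps_X) * rhat * inverse (4 * (1 - fps_X)))"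

text \<open>Existence and uniqueness are lemma \<open>Qhat_ex1\<close> below.\<close>
definition Qhat :: "rat fps" where
  "Qhat = (THE Q. Q $ 0 = 0 \<and> (Q oo recip_affine 1 1) - (Q oo recip_affine 1 (- 1)) = fhat)"

text \<open>\<open>Qhat\<close> after the substitution \<open>s = (1 - Z) / 2\<close>.\<close>
definition Qhat_Z :: "rat fps" where
  "Qhat_Z = Qhat oo recip_affine (- 1 / 2) (1 / 2)"


subsection \<open>Well-definedness of \<open>Qhat\<close>\<close>

lemma recip_affine_power_nth:
  fixes b :: "'a::field"
  shows "i \<le> m \<Longrightarrow> (recip_affine 1 b ^ i) $ m = (inverse (1 + fps_const b * fps_X) ^ i) $ (m - i)"
  by (simp add: recip_affine_def power_mult_distrib fps_X_power_mult_nth)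

lemma fps_power_nth_1:
  fixes U :: "'a::comm_ring_1 fps"
  assumes "U $ 0 = 1"
  shows "(U ^ n) $ 1 = of_nat n * U $ 1"
proof (induction n)
  case (Suc n)
  then show ?case
    by (simp add: fps_mult_nth_1 assms fps_nth_power_0 algebra_simps)
qed auto

lemma recip_affine_power_diag: "(recip_affine 1 b ^ n) $ n = (1::'a::field)"
  by (simp add: recip_affine_power_nth fps_nth_power_0)

lemma recip_affine_power_subdiag:
  "(recip_affine 1 b ^ n) $ Suc n = - of_nat n * (b::'a::field)"
proof -
  define U where "U = inverse (1 + fps_const b * fps_X)"
  have U0: "U $ 0 = 1" by (simp add: U_def)
  have "U * (1 + fps_const b * fps_X) = 1"
    unfolding U_def by (rule inverse_mult_eq_1) simp
  then have "(U * (1 + fps_const b * fps_X)) $ 1 = 0" by simp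
  then have "U $ 1 = - b" using U0 by (simp add: fps_mult_nth_1 add_eq_0_iff)
  then show ?thesis
    using fps_power_nth_1[OF U0, of n] by (simp add: recip_affine_power_nth U_def)
qed

lemma Qhat_ex1_general:
  fixes f :: "'a::field_char_0 fps"
  assumes f0: "f $ 0 = 0" and f1: "f $ 1 = 0"
  shows "\<exists>!Q. Q $ 0 = 0 \<and> (Q oo recip_affine 1 1) - (Q oo recip_affine 1 (- 1)) = f"
proof -
  define d where
    "d = (\<lambda>i m. (recip_affine 1 1 ^ i) $ m - (recip_affine 1 (- 1) ^ i) $ m :: 'a)"
  have d0: "d 0 m = 0" for m by (simp add: d_def)
  have dd: "d m m = 0" for m by (simp add: d_def recip_affine_power_diag)
  have ds: "d n (Suc n) = - 2 * of_nat n" for n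
    by (simp add: d_def recip_affine_power_subdiag)
  have comp: "((Q oo recip_affine 1 1) - (Q oo recip_affine 1 (- 1))) $ m = (\<Sum>i=0..m. Q $ i * d i m)"
    for Q m
    by (simp add: fps_compose_nth d_def sum_subtractf algebra_simps)
  have step: "(\<Sum>i=0..Suc n. Q $ i * d i (Suc n)) = (\<Sum>i<n. Q $ i * d i (Suc n)) - 2 * of_nat n * Q $ n"
    for Q :: "'a fps" and n
    by (simp add: atLeast0AtMost dd ds flip: lessThan_Suc_atMost)
  have eqn: "((Q oo recip_affine 1 1) - (Q oo recip_affine 1 (- 1)) = f) \<longleftrightarrow>
      (\<forall>n\<ge>1. 2 * of_nat n * Q $ n = (\<Sum>i<n. Q $ i * d i (Suc n)) - f $ Suc n)" for Q
  proof -
    have "((Q oo recip_affine 1 1) - (Q oo recip_affine 1 (- 1)) = f) \<longleftrightarrow>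
        (\<forall>m. (\<Sum>i=0..m. Q $ i * d i m) = f $ m)"
      by (simp only: fps_eq_iff comp)
    also have "\<dots> \<longleftrightarrow> (\<forall>n\<ge>1. (\<Sum>i=0..Suc n. Q $ i * d i (Suc n)) = f $ Suc n)" (is "?l \<longleftrightarrow> ?r")
    proof
      assume r: ?r
      show ?l
      proof
        fix m
        consider "m = 0" | "m = 1" | n where "m = Suc n" "n \<ge> 1"
          by (cases m) (auto simp: Suc_le_eq)
        then show "(\<Sum>i=0..m. Q $ i * d i m) = f $ m"
        proof cases
          case 1 then show ?thesis by (simp add: d0 f0)
        next
          case 2 then show ?thesis using step[of Q 0] f1 by simp
        next
          case 3 then show ?thesis using r by blast
        qed
      qed
    qed blast
    also have "\<dots> \<longleftrightarrow> (\<forall>n\<ge>1. 2 * of_nat n * Q $ n = (\<Sum>i<n. Q $ i * d i (Suc n)) - f $ Suc n)"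
      unfolding step by (auto simp: algebra_simps)
    finally show ?thesis .
  qed
  define R where "R = (\<lambda>q n. if n = 0 then 0 else
      ((\<Sum>i<n. q i * d i (Suc n)) - f $ Suc n) / (2 * of_nat n))"
  define q where "q = wfrec less_than R"
  have "adm_wf less_than R"
    by (auto simp: adm_wf_def R_def intro!: sum.cong arg_cong2[where f = "(/)"])
  then have q: "q n = R q n" for n
    unfolding q_def by (metis wfrec_fixpoint wf_less_than)
  have ex: "Abs_fps q $ 0 = 0 \<and> (Abs_fps q oo recip_affine 1 1) - (Abs_fps q oo recip_affine 1 (- 1)) = f"
    unfolding eqn using q by (simp add: R_def)
  show ?thesis
  proof (rule ex1I[where a = "Abs_fps q"], rule ex)
    fix Q assume Q: "Q $ 0 = 0 \<and> (Q oo recip_affine 1 1) - (Q oo recip_affine 1 (- 1)) = f"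
    have "Q $ n = q n" for n
    proof (induction n rule: less_induct)
      case (less n)
      show ?case
      proof (cases "n = 0")
        case True then show ?thesis using Q q[of 0] by (simp add: R_def)
      next
        case False
        then have "2 * of_nat n * Q $ n = (\<Sum>i<n. Q $ i * d i (Suc n)) - f $ Suc n"
          using Q unfolding eqn by simp
        also have "(\<Sum>i<n. Q $ i * d i (Suc n)) = (\<Sum>i<n. q i * d i (Suc n))"
          using less by simp
        finally have "2 * of_nat n * Q $ n = 2 * of_nat n * q n"
          using False q[of n] by (simp add: R_def)
        then show ?thesis using False by simp
      qed
    qed
    then show "Q = Abs_fps q" by (simp add: fps_eq_iff)
  qed
qed

lemma Qhat_ex1:
  "\<exists>!Q. Q $ 0 = 0 \<and> (Q oo recip_affine 1 1) - (Q oo recip_affine 1 (- 1)) = fhat"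
proof (rule Qhat_ex1_general)
  define h where "h = - ((2 - fps_X) * rhat * inverse (4 * (1 - fps_X)))"
  have fhat: "fhat = fps_X ^ 2 * h"
    by (simp add: fhat_def h_def mult.assoc)
  show "fhat $ 0 = 0" "fhat $ 1 = 0"
    unfolding fhat fps_X_power_mult_nth by simp_all
qed


subsection \<open>Polynomiality of \<open>Lcoeff\<close>\<close>

definition polyfun2 :: "(complex \<Rightarrow> complex \<Rightarrow> complex) \<Rightarrow> bool" where
  "polyfun2 f \<longleftrightarrow> (\<exists>P :: complex poly poly. \<forall>A B. f A B = poly (poly P [:A:]) B)"

lemma polyfun2_const: "polyfun2 (\<lambda>A B. c)"
  unfolding polyfun2_def by (rule exI[of _ "[:[:c:]:]"]) simp

lemma polyfun2_fst: "polyfun2 (\<lambda>A B. A)"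
  unfolding polyfun2_def by (rule exI[of _ "[:0, 1:]"]) simp

lemma polyfun2_snd: "polyfun2 (\<lambda>A B. B)"
  unfolding polyfun2_def by (rule exI[of _ "[:[:0, 1:]:]"]) simp

lemma polyfun2_add: "polyfun2 f \<Longrightarrow> polyfun2 h \<Longrightarrow> polyfun2 (\<lambda>A B. f A B + h A B)"
  unfolding polyfun2_def by (metis poly_add)

lemma polyfun2_mult: "polyfun2 f \<Longrightarrow> polyfun2 h \<Longrightarrow> polyfun2 (\<lambda>A B. f A B * h A B)"
  unfolding polyfun2_def by (metis poly_mult)

lemma polyfun2_diff: "polyfun2 f \<Longrightarrow> polyfun2 h \<Longrightarrow> polyfun2 (\<lambda>A B. f A B - h A B)"
  unfolding polyfun2_def by (metis poly_diff)

lemma polyfun2_sum: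
  "(\<And>i. i \<in> S \<Longrightarrow> polyfun2 (f i)) \<Longrightarrow> polyfun2 (\<lambda>A B. \<Sum>i\<in>S. f i A B)"
  by (induction S rule: infinite_finite_induct) (auto intro: polyfun2_const polyfun2_add)

lemma polyfun2_prod:
  "(\<And>i. i \<in> S \<Longrightarrow> polyfun2 (f i)) \<Longrightarrow> polyfun2 (\<lambda>A B. \<Prod>i\<in>S. f i A B)"
  by (induction S rule: infinite_finite_induct) (auto intro: polyfun2_const polyfun2_mult)

lemmas polyfun2_intros =
  polyfun2_const polyfun2_fst polyfun2_snd polyfun2_mult polyfun2_diff polyfun2_sum polyfun2_prod

lemma polyfun2_acoeff: "polyfun2 (\<lambda>A B. acoeff k A)" "polyfun2 (\<lambda>A B. acoeff k B)"
  unfolding acoeff_def divide_inverse by (intro polyfun2_intros)+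

lemma polyfun2_Fseries: "polyfun2 (\<lambda>A B. Fseries A B $ m)"
  unfolding Fseries_def Gcoeff_def fps_nth_Abs_fps fps_sum_nth fps_mult_left_const_nth
  by (intro polyfun2_intros polyfun2_acoeff)

lemma polyfun2_power_nth:
  assumes "\<And>m. polyfun2 (\<lambda>A B. h A B $ m)"
  shows "polyfun2 (\<lambda>A B. (h A B ^ k) $ m)"
proof (induction k arbitrary: m)
  case 0
  then show ?case by (simp add: polyfun2_const)
next
  case (Suc k)
  show ?case
    unfolding power_Suc fps_mult_nth by (intro polyfun2_intros assms Suc)
qed

lemma Lcoeff_polynomial:
  "\<exists>P :: complex poly poly. \<forall>A B. Lcoeff n A B = poly (poly P [:A:]) B"
proof -
  have "polyfun2 (Lcoeff n)"
    unfolding Lcoeff_def logF_def fps_compose_nth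
    by (intro polyfun2_intros polyfun2_power_nth; simp add: polyfun2_Fseries polyfun2_diff polyfun2_const)
  then show ?thesis by (simp add: polyfun2_def)
qed

end

theory Submission
  imports Defs
begin

text \<open>
  The series \<open>F\<close> is a formal Mellin transform. Since \<open>1 / ((Z-1)\<cdots>(Z-n)) = \<Gamma>(Z-n) / \<Gamma>(Z)\<close> and
  \<open>\<Sum> a\<^sub>k(\<nu>) / x\<^sup>k\<close> is the amplitude of the Bessel function \<open>K\<^sub>\<nu>(x)\<close>, formally \<open>\<Gamma>(Z) F(Z)\<close> is up to a
  constant the Mellin transform at \<open>Z + 1\<close> of \<open>K\<^sub>\<alpha>(x/p) K\<^sub>\<beta>(x/q)\<close>; here \<open>1/p + 1/q = 1\<close> supplies the factor
  \<open>exp (- x)\<close>. The product of the two Bessel functions and of their Euler derivatives satisfies a first-order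
  system, whose transform is a difference equation in \<open>Z\<close> (\<open>Fseries_recurrence\<close>): with \<open>z = Z + 1\<close>, \<open>X = 1/z\<close>,
  \<open>\<sigma> = A + B\<close>, \<open>\<delta> = A - B\<close>,
  \<open>(1 + 2X) (1 - 2\<sigma>X\<^sup>2 + \<delta>\<^sup>2X\<^sup>4) F(Z) = (1 - X\<^sup>2) ((1 + 2X) F(Z+4) + 2i\<delta>X\<^sup>2 F(Z+2))\<close>.

  At \<open>A = B = 0\<close> this is a two-term equation \<open>F(Z) = (1 - X\<^sup>2) F(Z+4)\<close>. Its step-two quotient \<open>F(Z+2) / F(Z)\<close> is
  therefore determined, and up to the factor \<open>2 (1 - X)\<close> it is the Gamma quotient \<open>rhat\<close> at
  \<open>s = - z/2\<close> (\<open>Fseries_0_ratio\<close>). Differentiation of the recurrence in \<open>A\<close> at \<open>0\<close> then gives a first-order difference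
  equation for \<open>H = \<Sum> g\<^sub>n Z\<^sup>-\<^sup>n\<close>, the logarithmic derivative of \<open>F\<close> (\<open>g_series_shift\<close>):
  \<open>H(Z+4) - H(Z) = - 2X\<^sup>2 - i X\<^sup>2 (1 + X) rhat(-z/2) / (1 + 2X)\<close>.
  The first term on the right is accounted for by the three trigamma series, from \<open>\<psi>'(x+1) = \<psi>'(x) - 1/x\<^sup>2\<close>;
  the second is \<open>(i/2) fhat(- z/2)\<close>, which is what the defining equation of \<open>Qhat\<close> gives for \<open>- (i/2) Qhat\<close>,
  because \<open>Z \<mapsto> Z + 4\<close> lowers \<open>s = (1 - Z)/2\<close> by \<open>2\<close>. A series without constant term that is invariant under a
  nontrivial shift is zero (\<open>shift_eq_self_imp_0\<close>), so both sides agree. The same principle shows that the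
  coefficients of the trigamma part are real, which isolates the imaginary parts.

  The functional equations of the asymptotic series of \<open>\<psi>'\<close> and of the Gamma quotient are proved without
  analysis: the formal Borel transform, \<open>Z\<^sup>-\<^sup>n\<^sup>-\<^sup>1 \<mapsto> t\<^sup>n / n!\<close>, turns the shift \<open>Z \<mapsto> Z + c\<close> into multiplication by
  \<open>exp (- c t)\<close>, and in \<open>t\<close> the equations are identities between generating functions of Bernoulli polynomials.
\<close>

section \<open>Affine substitutions at infinity\<close>

lemma fps_nonzeroI: "f $ 0 \<noteq> 0 \<Longrightarrow> f \<noteq> (0 :: 'a::zero fps)"
  by auto

lemma recip_affine_nth_0 [simp]: "recip_affine a b $ 0 = 0"
  by (simp add: recip_affine_def)

lemma recip_affine_mult:
  assumes "a \<noteq> (0::'a::field)"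
  shows "recip_affine a b * (fps_const a + fps_const b * fps_X) = fps_X"
  using inverse_mult_eq_1[of "fps_const a + fps_const b * fps_X"] assms
  by (simp add: recip_affine_def mult.assoc)

lemma recip_affine_0: "a \<noteq> (0::'a::field) \<Longrightarrow> recip_affine a 0 = fps_const (inverse a) * fps_X"
  by (simp add: recip_affine_def mult.commute fps_const_inverse)

lemma recip_affine_compose:
  assumes "a \<noteq> 0" "c \<noteq> (0::'a::field)"
  shows "recip_affine a b oo recip_affine c d = recip_affine (a * c) (a * d + b)"
proof -
  let ?r = "recip_affine c d" and ?R = "recip_affine a b oo recip_affine c d"
  let ?l = "fps_const (a * c) + fps_const (a * d + b) * fps_X"
  have 1: "?R * (fps_const a + fps_const b * ?r) = ?r"
    using arg_cong[OF recip_affine_mult[OF assms(1), of b], of "\<lambda>f. f oo ?r"]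
    by (simp add: fps_compose_mult_distrib fps_compose_add_distrib)
  have 2: "?r * (fps_const c + fps_const d * fps_X) = fps_X"
    by (rule recip_affine_mult[OF assms(2)])
  have "?l = fps_const a * (fps_const c + fps_const d * fps_X)
      + fps_const b * (?r * (fps_const c + fps_const d * fps_X))"
    unfolding 2 by (simp add: algebra_simps flip: fps_const_mult fps_const_add)
  then have "?R * ?l = (?R * (fps_const a + fps_const b * ?r)) * (fps_const c + fps_const d * fps_X)"
    by (simp only: distrib_left distrib_right mult_ac add_ac)
  also have "\<dots> = fps_X"
    using 1 2 by simp
  finally have "?R * ?l = fps_X" .
  moreover have "recip_affine (a * c) (a * d + b) * ?l = fps_X"
    by (rule recip_affine_mult) (use assms in simp)
  moreover have "?l \<noteq> 0"
    using assms by (intro fps_nonzeroI) simp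
  ultimately show ?thesis
    by (metis mult_right_cancel)
qed

lemma recip_affine_1_mult: "recip_affine 1 c * (1 + fps_const c * fps_X) = (fps_X :: 'a::field fps)"
  using recip_affine_mult[of 1 c] by simp

lemma recip_affine_1_0: "recip_affine 1 0 = (fps_X :: 'a::field fps)"
  by (simp add: recip_affine_0)

lemma recip_affine_diff:
  "recip_affine 1 c - recip_affine 1 d = fps_const (d - c) * recip_affine 1 c * recip_affine (1::'a::field) d"
proof -
  let ?r = "recip_affine 1 c" and ?s = "recip_affine 1 d"
  have "(?r - ?s) * ((1 + fps_const c * fps_X) * (1 + fps_const d * fps_X))
      = (?r * (1 + fps_const c * fps_X)) * (1 + fps_const d * fps_X)
      - (?s * (1 + fps_const d * fps_X)) * (1 + fps_const c * fps_X)"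
    by (simp only: left_diff_distrib) (simp only: mult_ac)
  also have "\<dots> = fps_const (d - c) * (?r * (1 + fps_const c * fps_X)) * (?s * (1 + fps_const d * fps_X))"
    unfolding recip_affine_1_mult by (simp add: algebra_simps flip: fps_const_sub fps_const_mult)
  also have "\<dots> = (fps_const (d - c) * ?r * ?s) * ((1 + fps_const c * fps_X) * (1 + fps_const d * fps_X))"
    by (simp only: mult_ac)
  finally have "(?r - ?s) * ((1 + fps_const c * fps_X) * (1 + fps_const d * fps_X))
      = (fps_const (d - c) * ?r * ?s) * ((1 + fps_const c * fps_X) * (1 + fps_const d * fps_X))" .
  moreover have "(1 + fps_const c * fps_X) * (1 + fps_const d * fps_X) \<noteq> 0"
    by (rule fps_nonzeroI) simp
  ultimately show ?thesis
    by (metis mult_right_cancel)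
qed

lemma recip_affine_scale:
  assumes "a \<noteq> (0::'a::field)"
  shows "recip_affine a b = fps_const (1 / a) * recip_affine 1 (b / a)"
proof -
  let ?l = "fps_const a + fps_const b * fps_X"
  have "fps_const (1 / a) * recip_affine 1 (b / a) * ?l
      = recip_affine 1 (b / a) * (fps_const (1 / a) * fps_const a + fps_const (1 / a) * fps_const b * fps_X)"
    by (simp only: distrib_left mult_ac)
  also have "\<dots> = fps_X"
    using assms recip_affine_1_mult[of "b / a"] by simp
  finally show ?thesis
    using recip_affine_mult[OF assms, of b] by (metis fps_X_neq_zero mult_eq_0_iff mult_right_cancel)
qed

lemma fps_compose_recip_affine:
  assumes "a \<noteq> 0" "c \<noteq> (0::'a::field)"
  shows "(f oo recip_affine a b) oo recip_affine c d = f oo recip_affine (a * c) (a * d + b)"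
  using assms by (simp add: recip_affine_compose flip: fps_compose_assoc)

text \<open>The substitution \<open>Z \<mapsto> Z + c\<close>.\<close>
definition shift :: "'a::field \<Rightarrow> 'a fps \<Rightarrow> 'a fps" where
  "shift c f = f oo recip_affine 1 c"

lemma shift_add: "shift c (f + h) = shift c f + shift c h"
  and shift_diff: "shift c (f - h) = shift c f - shift c h"
  and shift_minus: "shift c (- f) = - shift c f"
  and shift_mult: "shift c (f * h) = shift c f * shift c h"
  and shift_power: "shift c (f ^ n) = shift c f ^ n"
  and shift_const: "shift c (fps_const a) = fps_const a"
  and shift_1: "shift c 1 = 1"
  and shift_numeral: "shift c (numeral w) = numeral w"
  and shift_X: "shift c fps_X = recip_affine 1 c"
  by (simp_all add: shift_def fps_compose_add_distrib fps_compose_sub_distrib fps_compose_uminus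
        fps_compose_mult_distrib fps_compose_power flip: numeral_fps_const)

lemmas shift_hom = shift_add shift_diff shift_minus shift_mult shift_power shift_const shift_1
  shift_numeral shift_X

lemma shift_recip_affine: "a \<noteq> 0 \<Longrightarrow> shift c (recip_affine a b) = recip_affine a (a * c + b)"
  by (simp add: shift_def recip_affine_compose)

lemma shift_compose_recip_affine:
  "a \<noteq> 0 \<Longrightarrow> shift c (f oo recip_affine a b) = f oo recip_affine a (a * c + b)"
  by (simp add: shift_def fps_compose_recip_affine)

lemma shift_compose_recip_affine_left:
  assumes "a \<noteq> (0::'a::field)"
  shows "shift c f oo recip_affine a b = f oo recip_affine a (b + c)"
  by (simp add: shift_def fps_compose_recip_affine assms)

lemma shift_shift: "shift c (shift d f) = shift (c + d) f"
  by (simp add: shift_def fps_compose_recip_affine)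

lemma shift_0: "shift 0 f = f"
  by (simp add: shift_def recip_affine_0)

lemma shift_nth_0 [simp]: "shift c f $ 0 = f $ 0"
  by (simp add: shift_def)

section \<open>The formal Borel transform\<close>

text \<open>
  The constant term is forgotten, which is harmless below: shifts preserve it, and it is compared separately.
\<close>
definition borel_transform :: "'a::field_char_0 fps \<Rightarrow> 'a fps" where
  "borel_transform f = Abs_fps (\<lambda>n. f $ Suc n / fact n)"

lemma borel_transform_add: "borel_transform (f + h) = borel_transform f + borel_transform h"
  and borel_transform_diff: "borel_transform (f - h) = borel_transform f - borel_transform h"
  by (simp_all add: borel_transform_def fps_eq_iff add_divide_distrib diff_divide_distrib)

lemma borel_transform_eqD:
  assumes "borel_transform f = borel_transform h" "f $ 0 = h $ 0"
  shows "f = h"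
proof (rule fps_ext)
  fix n
  show "f $ n = h $ n"
    using assms by (cases n) (auto simp: fps_eq_iff borel_transform_def)
qed

text \<open>The binomial series of \<open>(Z + c)\<^sup>-\<^sup>k\<^sup>-\<^sup>1\<close>.\<close>
lemma recip_affine_power_Suc_nth:
  fixes c :: "'a::field_char_0"
  shows "(recip_affine 1 c ^ Suc k) $ Suc n = (if k \<le> n then of_nat (n choose k) * (- c) ^ (n - k) else 0)"
proof (cases "k \<le> n")
  case True
  have "(recip_affine 1 c ^ Suc k) $ Suc n = (inverse ((1 - fps_const (- c) * fps_X) ^ Suc k)) $ (n - k)"
    using True by (simp only: recip_affine_power_nth Suc_le_mono fps_inverse_power) (simp flip: fps_const_neg)
  also have "\<dots> = of_nat (n choose (n - k)) * (- c) ^ (n - k)"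
    using True by (subst one_minus_const_fps_X_neg_power') simp_all
  finally show ?thesis
    using True by (simp add: binomial_symmetric[of k n])
next
  case False
  then show ?thesis
    by (simp only: recip_affine_def power_mult_distrib fps_X_power_mult_nth) simp
qed

text \<open>
  This is the reason for using the Borel transform: \<open>1 / (Z + c)\<^sup>n\<^sup>+\<^sup>1\<close> is the Laplace transform of
  \<open>exp (- c t) t\<^sup>n / n!\<close>.
\<close>
lemma borel_transform_shift: "borel_transform (shift c f) = fps_exp (- c) * borel_transform f"
proof (rule fps_ext)
  fix n
  have "shift c f $ Suc n = (\<Sum>i=0..Suc n. f $ i * (recip_affine 1 c ^ i) $ Suc n)"
    by (simp add: shift_def fps_compose_nth)
  also have "\<dots> = (\<Sum>k\<le>n. f $ Suc k * (recip_affine 1 c ^ Suc k) $ Suc n)"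
    by (simp only: sum.atLeast0_atMost_Suc_shift) (simp add: atLeast0AtMost)
  also have "\<dots> = (\<Sum>k\<le>n. f $ Suc k * (of_nat (n choose k) * (- c) ^ (n - k)))"
    by (simp only: recip_affine_power_Suc_nth) simp
  also have "\<dots> / fact n = (\<Sum>k\<le>n. f $ Suc k / fact k * ((- c) ^ (n - k) / fact (n - k)))"
    by (auto simp: sum_divide_distrib binomial_fact field_simps intro!: sum.cong)
  also have "\<dots> = (borel_transform f * fps_exp (- c)) $ n"
    by (simp add: fps_mult_nth borel_transform_def atLeast0AtMost)
  finally show "borel_transform (shift c f) $ n = (fps_exp (- c) * borel_transform f) $ n"
    by (simp add: borel_transform_def mult.commute)
qed

text \<open>
  The factor \<open>exp (- c t) - 1\<close> is nonzero for \<open>c \<noteq> 0\<close>. Hence an equation \<open>f(Z+c) - f(Z) = h(Z)\<close> has at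
  most one formal solution with a given constant term.
\<close>
lemma shift_eq_self_imp_0:
  fixes f :: "'a::field_char_0 fps"
  assumes "shift c f = f" "f $ 0 = 0" "c \<noteq> 0"
  shows "f = 0"
proof (rule borel_transform_eqD)
  have "(fps_exp (- c) - 1) * borel_transform f = 0"
    using borel_transform_shift[of c f] assms(1) by (simp add: algebra_simps)
  then have "borel_transform f = 0"
    using assms(3) by simp
  then show "borel_transform f = borel_transform 0"
    by (simp add: borel_transform_def fps_eq_iff)
qed (use assms in simp)

text \<open>
  A shift leaves the lowest nonzero coefficient \<open>a\<close> of a difference \<open>y - y'\<close> unchanged, so the lowest
  coefficient of \<open>y * shift c y - y' * shift c y'\<close> is \<open>2 a\<close>. So the equation \<open>y(Z) y(Z+c) = h(Z)\<close>
  determines \<open>y\<close>.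
\<close>
lemma fps_mult_shift_unique:
  fixes y y' :: "'a::field_char_0 fps"
  assumes "y * shift c y = y' * shift c y'" "y $ 0 = 1" "y' $ 0 = 1"
  shows "y = y'"
proof (rule ccontr)
  define D where "D = y - y'"
  assume "y \<noteq> y'"
  then have "D \<noteq> 0" by (simp add: D_def)
  define n where "n = subdegree D"
  have low: "D $ i = 0" if "i < n" for i
    using that unfolding n_def by (rule nth_less_subdegree_zero)
  have "D * shift c y + y' * shift c D = 0"
    using assms(1) unfolding D_def shift_diff by (simp add: algebra_simps)
  moreover have "(D * shift c y) $ n = D $ n"
    unfolding n_def by (subst fps_mult_nth_conv_upto_subdegree_left) (use assms in simp)
  moreover have "shift c D $ i = (if i = n then D $ n else 0)" if "i \<le> n" for i
  proof -
    have "shift c D $ i = (\<Sum>j=0..i. if j = n then D $ n else 0)"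
      unfolding shift_def fps_compose_nth using that low recip_affine_power_diag[of c n]
      by (intro sum.cong) (auto simp: le_less dest: le_less_trans)
    then show ?thesis using that by auto
  qed
  then have "(y' * shift c D) $ n = (\<Sum>i=0..n. if i = 0 then y' $ 0 * D $ n else 0)"
    unfolding fps_mult_nth by (intro sum.cong) auto
  then have "(y' * shift c D) $ n = D $ n"
    using assms(3) by simp
  ultimately have "D $ n + D $ n = 0"
    by (metis fps_add_nth fps_zero_nth)
  then show False
    using \<open>D \<noteq> 0\<close> by (simp add: n_def flip: mult_2)
qed

section \<open>The difference equation of the trigamma series\<close>

lemma bernoulli_poly_egf:
  "Abs_fps (\<lambda>n. bernoulli_poly n x / fact n) * (fps_exp 1 - 1) = fps_X * fps_exp (x::'a::field_char_0)"
proof -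
  have "subdegree (fps_exp 1 - 1 :: 'a fps) = 1"
    by (rule subdegreeI) auto
  moreover have "subdegree (fps_X * fps_exp x) = 1"
    by (rule subdegreeI) auto
  ultimately have "(fps_exp 1 - 1) dvd (fps_X * fps_exp x)"
    by (subst fps_dvd_iff) auto
  moreover have "Abs_fps (\<lambda>n. bernoulli_poly n x / fact n) = (fps_X * fps_exp x) / (fps_exp 1 - 1)"
    by (simp add: fps_eq_iff bernoulli_poly_def)
  ultimately show ?thesis
    by simp
qed

text \<open>
  The Borel transform of \<open>\<psi>'\<close> is \<open>t / (1 - exp (- t))\<close>, that is, the Bernoulli generating function
  \<open>b(t) = t / (exp t - 1)\<close> at \<open>- t\<close>. The defining formula of \<^const>\<open>trigamma_series\<close> takes \<open>+1/2\<close> in place of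
  \<open>B\<^sub>1\<close> and drops \<open>B\<^sub>n\<close> for odd \<open>n \<ge> 3\<close>; both are contained in \<open>b(- t) = b(t) + t\<close>.
\<close>
lemma borel_transform_trigamma: "borel_transform trigamma_series * (1 - fps_exp (- 1)) = fps_X"
proof -
  define b where "b = Abs_fps (\<lambda>n. bernoulli_poly n (0::complex) / fact n)"
  have b: "b * (fps_exp 1 - 1) = fps_X"
    using bernoulli_poly_egf[of "0::complex"] by (simp add: b_def)
  have "(b oo - fps_X) * (fps_exp (- 1) - 1) = - fps_X"
    using arg_cong[OF b, of "\<lambda>f. f oo - fps_X"]
    by (simp add: fps_compose_mult_distrib fps_compose_sub_distrib)
  then have refl: "(b oo - fps_X) * (1 - fps_exp (- 1)) = fps_X"
    by (simp add: algebra_simps)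
  have e: "fps_exp 1 * fps_exp (- 1) = (1 :: complex fps)"
    using fps_exp_add_mult[of 1 "- 1 :: complex"] by simp
  have "(b oo - fps_X) * (fps_exp 1 - 1) = (b + fps_X) * (fps_exp 1 - 1)"
  proof -
    have "(b oo - fps_X) * (fps_exp 1 - 1) = fps_exp 1 * ((b oo - fps_X) * (1 - fps_exp (- 1)))"
      using e by (simp add: algebra_simps)
    also have "\<dots> = (b + fps_X) * (fps_exp 1 - 1)"
      unfolding refl using b by (simp add: algebra_simps)
    finally show ?thesis .
  qed
  then have "b oo - fps_X = b + fps_X"
    by (subst (asm) mult_right_cancel) simp_all
  then have sym: "(- 1) ^ n * b $ n = b $ n + (if n = 1 then 1 else 0)" for n
    by (simp add: fps_compose_uminus' fps_eq_iff)
  \<comment> \<open>\<open>sym\<close> settles the odd coefficients; the constant term is read off from \<open>b (exp t - 1) = t\<close>\<close>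
  have b0: "b $ 0 = 1"
  proof -
    have "(b * (fps_exp 1 - 1)) $ 1 = 1"
      by (simp add: b)
    then show ?thesis
      by (simp add: fps_mult_nth_1)
  qed
  have "borel_transform trigamma_series = b oo - fps_X"
  proof (rule fps_ext)
    fix n :: nat
    \<comment> \<open>the sign of \<open>b\<^sub>1\<close> is opposite to that of the second coefficient of the trigamma series\<close>
    have b1: "b $ Suc 0 = - 1 / 2"
    proof -
      have "2 * b $ Suc 0 = - 1"
        using sym[of 1] by (simp add: eq_neg_iff_add_eq_0)
      then show ?thesis
        by (simp add: field_simps)
    qed
    consider "n = 0" | "n = 1" | "n \<ge> 2" "even n" | "n \<ge> 2" "odd n"
      by linarith
    then show "borel_transform trigamma_series $ n = (b oo - fps_X) $ n"
    proof cases
      case 4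
      then have "b $ n = 0"
        using sym[of n] by auto
      with 4 show ?thesis
        by (auto simp: borel_transform_def trigamma_series_def fps_compose_uminus')
    qed (use b0 b1 in \<open>auto simp: borel_transform_def trigamma_series_def fps_compose_uminus' b_def\<close>)
  qed
  then show ?thesis
    using refl by simp
qed

lemma trigamma_series_shift: "shift 1 trigamma_series = trigamma_series - fps_X\<^sup>2"
proof (rule borel_transform_eqD)
  have "borel_transform (fps_X\<^sup>2) = (fps_X :: complex fps)"
    by (simp add: borel_transform_def fps_eq_iff power2_eq_square)
  then show "borel_transform (shift 1 trigamma_series) = borel_transform (trigamma_series - fps_X\<^sup>2)"
    unfolding borel_transform_shift borel_transform_diff
    using borel_transform_trigamma by (simp add: algebra_simps)
qed simp

text \<open>A shift of \<open>Z\<close> by \<open>1/a\<close> increases the argument \<open>a Z + b\<close> by one.\<close>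
lemma trigamma_compose_shift:
  assumes "a \<noteq> 0" "a * c = 1"
  shows "shift c (trigamma_series oo recip_affine a b)
    = (trigamma_series oo recip_affine a b) - (recip_affine a b)\<^sup>2"
proof -
  have "shift c (trigamma_series oo recip_affine a b) = shift 1 trigamma_series oo recip_affine a b"
    using assms by (simp add: shift_compose_recip_affine shift_compose_recip_affine_left add.commute)
  then show ?thesis
    using recip_affine_nth_0[of a b]
    by (simp add: trigamma_series_shift fps_compose_sub_distrib fps_compose_mult_distrib power2_eq_square)
qed

definition trigamma_part :: "complex fps" where
  "trigamma_part = fps_const (1 / 16) * (trigamma_series oo recip_affine (1 / 4) (1 / 4))
         - fps_const (1 / 16) * (trigamma_series oo recip_affine (1 / 4) (3 / 4))
         + fps_const (1 / 4) * (trigamma_series oo recip_affine (1 / 2) (1 / 2))"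

text \<open>
  A step of \<open>4\<close> raises the argument \<open>(Z + j) / 4\<close> by one and \<open>(Z + 1) / 2\<close> by two. The contributions of \<open>1 / (Z + 3)\<^sup>2\<close>
  cancel, those of \<open>1 / (Z + 1)\<^sup>2\<close> add up.
\<close>
lemma trigamma_part_shift: "shift 4 trigamma_part = trigamma_part - 2 * (recip_affine 1 1)\<^sup>2"
proof -
  have sc: "recip_affine (1 / 4) (1 / 4) = fps_const 4 * recip_affine 1 (1::complex)"
    "recip_affine (1 / 4) (3 / 4) = fps_const 4 * recip_affine 1 (3::complex)"
    "recip_affine (1 / 2) (1 / 2) = fps_const 2 * recip_affine 1 (1::complex)"
    "recip_affine (1 / 2) (3 / 2) = fps_const 2 * recip_affine 1 (3::complex)"
    using recip_affine_scale[of "1 / 4 :: complex" "1 / 4"] recip_affine_scale[of "1 / 4 :: complex" "3 / 4"]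
      recip_affine_scale[of "1 / 2 :: complex" "1 / 2"] recip_affine_scale[of "1 / 2 :: complex" "3 / 2"]
    by simp_all
  let ?h = "trigamma_series oo recip_affine (1 / 2) (1 / 2)"
  have "shift 2 ?h = ?h - (recip_affine (1 / 2) (1 / 2))\<^sup>2"
    by (rule trigamma_compose_shift) simp_all
  moreover have "shift 2 (trigamma_series oo recip_affine (1 / 2) (3 / 2))
      = (trigamma_series oo recip_affine (1 / 2) (3 / 2)) - (recip_affine (1 / 2) (3 / 2))\<^sup>2"
    by (rule trigamma_compose_shift) simp_all
  moreover have "shift 2 ?h = trigamma_series oo recip_affine (1 / 2) (3 / 2)"
    by (simp add: shift_compose_recip_affine)
  moreover have "shift 4 ?h = shift 2 (shift 2 ?h)"
    by (simp add: shift_shift)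
  ultimately have "shift 4 ?h = ?h - (recip_affine (1 / 2) (1 / 2))\<^sup>2 - (recip_affine (1 / 2) (3 / 2))\<^sup>2"
    by simp
  moreover have "fps_const (1 / 16) * (recip_affine (1 / 4) (1 / 4))\<^sup>2 = (recip_affine 1 (1::complex))\<^sup>2"
    "fps_const (1 / 16) * (recip_affine (1 / 4) (3 / 4))\<^sup>2 = (recip_affine 1 (3::complex))\<^sup>2"
    "fps_const (1 / 4) * (recip_affine (1 / 2) (1 / 2))\<^sup>2 = (recip_affine 1 (1::complex))\<^sup>2"
    "fps_const (1 / 4) * (recip_affine (1 / 2) (3 / 2))\<^sup>2 = (recip_affine 1 (3::complex))\<^sup>2"
    by (simp_all add: sc power_mult_distrib flip: mult.assoc)
  moreover have "shift 4 (trigamma_series oo recip_affine (1 / 4) b)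
      = (trigamma_series oo recip_affine (1 / 4) b) - (recip_affine (1 / 4) b)\<^sup>2" for b
    by (rule trigamma_compose_shift) simp_all
  ultimately show ?thesis
    unfolding trigamma_part_def shift_hom by (simp add: right_diff_distrib)
qed

section \<open>The difference equations of the Gamma quotient and of its formal primitive\<close>

text \<open>
  By Stirling's series, the asymptotic series of \<open>2 log (\<Gamma>(s/2) / \<Gamma>(s/2 + 1/2)) + log (s/2)\<close>.
\<close>
definition rhat_exponent :: "rat fps" where
  "rhat_exponent = 2 * Abs_fps (\<lambda>n.
     if n = 0 then 0
     else (- 1) ^ (n + 1) * (bernoulli_poly (n + 1) 0 - bernoulli_poly (n + 1) (1 / 2))
            / (of_nat n * of_nat (n + 1)) * 2 ^ n)"

lemma fps_exp_double_minus_1: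
  "fps_exp 1 - 1 = (fps_exp (1/2) - 1) * (fps_exp (1/2) + 1 :: rat fps)"
  using fps_exp_add_mult[of "1/2" "1/2 :: rat"] by (simp add: algebra_simps)

text \<open>
  The transform is \<open>tanh (t/2) / t\<close>. The difference \<open>G\<close> of the generating functions for the arguments \<open>0\<close> and \<open>1/2\<close> is
  \<open>- x / (exp (x/2) + 1)\<close>, because \<open>exp x - 1\<close> factors; the powers \<open>2\<^sup>n\<close> and signs of the exponent amount to
  evaluating \<open>G\<close> at \<open>x = - 2 t\<close>.
\<close>
lemma borel_transform_rhat_exponent:
  "fps_X * (borel_transform rhat_exponent * (1 + fps_exp 1)) = fps_exp 1 - 1"
proof -
  define G where "G = Abs_fps (\<lambda>n. (bernoulli_poly n 0 - bernoulli_poly n (1 / 2)) / fact n :: rat)"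
  have G: "G = Abs_fps (\<lambda>n. bernoulli_poly n 0 / fact n) - Abs_fps (\<lambda>n. bernoulli_poly n (1 / 2) / fact n)"
    by (simp add: G_def fps_eq_iff diff_divide_distrib)
  have "G * (fps_exp 1 - 1) = fps_X * (1 - fps_exp (1/2))"
    using bernoulli_poly_egf[of "0::rat"] bernoulli_poly_egf[of "1/2::rat"]
    unfolding G by (simp only: left_diff_distrib) (simp add: algebra_simps)
  then have "(G * (fps_exp (1/2) + 1)) * (fps_exp (1/2) - 1) = (- fps_X) * (fps_exp (1/2) - 1)"
    unfolding fps_exp_double_minus_1 by (simp add: algebra_simps)
  then have G: "G * (fps_exp (1/2) + 1) = - fps_X"
    by (subst (asm) mult_right_cancel) simp_all
  have G0: "G $ 0 = 0"
    using arg_cong[OF G, of "\<lambda>f. f $ 0"] by simp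
  have G1: "G $ Suc 0 = - 1 / 2"
    using arg_cong[OF G, of "\<lambda>f. f $ 1"] G0 by (simp add: fps_mult_nth_1)
  define H where "H = G oo (fps_const (- 2) * fps_X)"
  have HE: "H * (fps_exp (- 1) + 1) = 2 * fps_X"
    using arg_cong[OF G, of "\<lambda>f. f oo (fps_const (- 2) * fps_X)"] fps_exp_compose_linear[of "1/2" "- 2 :: rat"]
    by (simp add: H_def fps_compose_mult_distrib fps_compose_add_distrib fps_compose_uminus
          flip: numeral_fps_const)
  \<comment> \<open>\<open>H\<close> has linear term \<open>t\<close>, which comes from \<open>B\<^sub>1\<close>; the exponent starts with \<open>B\<^sub>2\<close>\<close>
  have HB: "fps_X\<^sup>2 * borel_transform rhat_exponent = H - fps_X"
  proof (rule fps_ext)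
    fix n
    consider "n = 0" | "n = 1" | m where "n = Suc (Suc m)"
      by (metis One_nat_def not0_implies_Suc)
    then show "(fps_X\<^sup>2 * borel_transform rhat_exponent) $ n = (H - fps_X) $ n"
    proof cases
      case 3
      have "borel_transform rhat_exponent $ m = (- 2) ^ n * G $ n"
        unfolding 3 by (simp add: borel_transform_def rhat_exponent_def G_def power_minus'
            numeral_fps_const field_simps)
      then show ?thesis
        by (simp add: 3 H_def fps_compose_linear fps_X_power_mult_nth)
    qed (auto simp: H_def G0 G1 fps_compose_linear fps_X_power_mult_nth)
  qed
  have "fps_X\<^sup>2 * borel_transform rhat_exponent * (fps_exp (- 1) + 1) = fps_X * (1 - fps_exp (- 1))"
    unfolding HB left_diff_distrib HE by (simp add: algebra_simps)
  then have "fps_X * (fps_X * borel_transform rhat_exponent * (fps_exp (- 1) + 1)) = fps_X * (1 - fps_exp (- 1))"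
    by (simp add: power2_eq_square mult_ac)
  then have "fps_X * borel_transform rhat_exponent * (fps_exp (- 1) + 1) = 1 - fps_exp (- 1)"
    by (subst (asm) mult_left_cancel) simp_all
  then have "fps_exp 1 * (fps_X * borel_transform rhat_exponent * (fps_exp (- 1) + 1)) = fps_exp 1 * (1 - fps_exp (- 1))"
    by simp
  then have "fps_X * (borel_transform rhat_exponent * (fps_exp 1 * fps_exp (- 1) + fps_exp 1))
      = fps_exp 1 - fps_exp 1 * fps_exp (- 1)"
    by (simp add: algebra_simps)
  moreover have "fps_exp 1 * fps_exp (- 1) = (1 :: rat fps)"
    using fps_exp_add_mult[of 1 "- 1 :: rat"] by simp
  ultimately show ?thesis
    by simp
qed

text \<open>The sum is \<open>- log (1 - 1/s)\<close>, since its Borel transform is \<open>(exp t - 1) / t\<close>.\<close>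
lemma deriv_rhat_exponent_sum:
  "(1 - fps_X) * fps_deriv (rhat_exponent + shift (- 1) rhat_exponent) = 1"
proof -
  let ?M = "rhat_exponent + shift (- 1) rhat_exponent"
  have "fps_X * borel_transform ?M = fps_exp 1 - 1"
    using borel_transform_rhat_exponent by (simp add: borel_transform_add borel_transform_shift algebra_simps)
  then have "(fps_X * borel_transform ?M) $ Suc n = (fps_exp 1 - 1) $ Suc n" for n
    by simp
  then have "borel_transform ?M $ n = 1 / fact (Suc n)" for n
    by (simp del: fact_Suc)
  then have "?M $ Suc n / fact n = 1 / (of_nat (Suc n) * fact n)" for n
    unfolding borel_transform_def fps_nth_Abs_fps fact_Suc .
  then have "?M $ Suc n / fact n = (1 / of_nat (Suc n)) / fact n" for n
    by (simp only: divide_divide_eq_left)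
  then have "?M $ Suc n = 1 / of_nat (Suc n)" for n
    by (simp only: divide_cancel_right fact_nonzero) blast
  then have "fps_deriv ?M = Abs_fps (\<lambda>_. 1)"
    by (simp add: fps_eq_iff del: fps_add_nth fps_deriv_add of_nat_Suc)
  then show ?thesis
    using inverse_mult_eq_1'[of "1 - fps_X :: rat fps"] by (simp add: fps_inverse_one_minus_fps_X)
qed

text \<open>
  The equation \<open>r(s) r(s - 1) = 4 s / (s - 1)\<close>, which for the Gamma quotient \<open>r(s) = s (\<Gamma>(s/2) / \<Gamma>(s/2 + 1/2))\<^sup>2\<close> is
  immediate. Formally, the logarithmic derivative of the left side is that of \<open>1 / (1 - 1/s)\<close>.
\<close>
lemma rhat_mult_shift: "(1 - fps_X) * (rhat * shift (- 1) rhat) = 4"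
proof -
  define E where "E = fps_exp 1 oo rhat_exponent"
  have rhat: "rhat = 2 * E"
    by (simp add: rhat_def E_def rhat_exponent_def)
  have e0: "rhat_exponent $ 0 = 0"
    by (simp add: rhat_exponent_def)
  have dE: "fps_deriv E = E * fps_deriv rhat_exponent"
    by (simp add: E_def fps_compose_deriv e0)
  have "shift (- 1) E = fps_exp 1 oo shift (- 1) rhat_exponent"
    by (simp add: E_def shift_def e0 flip: fps_compose_assoc)
  then have dS: "fps_deriv (shift (- 1) E) = shift (- 1) E * fps_deriv (shift (- 1) rhat_exponent)"
    by (simp add: fps_compose_deriv e0)
  define Y where "Y = E * shift (- 1) E"
  have "fps_deriv Y = Y * fps_deriv (rhat_exponent + shift (- 1) rhat_exponent)"
    by (simp add: Y_def dE dS algebra_simps)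
  then have "(1 - fps_X) * fps_deriv Y = Y * ((1 - fps_X) * fps_deriv (rhat_exponent + shift (- 1) rhat_exponent))"
    by (simp only: mult_ac)
  then have "fps_deriv ((1 - fps_X) * Y) = 0"
    unfolding deriv_rhat_exponent_sum by simp
  then have "(1 - fps_X) * Y = fps_const (((1 - fps_X) * Y) $ 0)"
    by (simp only: fps_deriv_eq_0_iff)
  also have "((1 - fps_X) * Y) $ 0 = 1"
    by (simp add: Y_def E_def)
  finally show ?thesis
    by (simp add: rhat shift_hom Y_def mult_ac)
qed

lemma rhat_nth_0: "rhat $ 0 = 2"
  by (simp add: rhat_def)

lemma Qhat_eq: "(Qhat oo recip_affine 1 1) - (Qhat oo recip_affine 1 (- 1)) = fhat"
  using theI'[OF Qhat_ex1] unfolding Qhat_def by blast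

lemma Qhat_nth_0: "Qhat $ 0 = 0"
  using theI'[OF Qhat_ex1] unfolding Qhat_def by blast

lemma fhat_mult: "4 * (1 - fps_X) * fhat = - (fps_X\<^sup>2 * (2 - fps_X) * rhat)"
proof -
  have "inverse (4 * (1 - fps_X)) * (4 * (1 - fps_X)) = (1 :: rat fps)"
    by (rule inverse_mult_eq_1) simp
  moreover have "4 * (1 - fps_X) * fhat
      = - (fps_X\<^sup>2 * (2 - fps_X) * rhat * (inverse (4 * (1 - fps_X)) * (4 * (1 - fps_X))))"
    unfolding fhat_def by (simp only: mult_minus_right mult_ac)
  ultimately show ?thesis
    by simp
qed

text \<open>The series \<open>rhat\<close> at \<open>s = - z/2\<close>, in powers of \<open>1/z\<close>.\<close>
definition rhat_half :: "rat fps" where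
  "rhat_half = rhat oo recip_affine (- 1 / 2) 0"

text \<open>
  The shift by \<open>-1\<close> makes \<open>z = Z + 1\<close> the variable, so that \<open>s = 1 - z/2\<close>. The step \<open>z \<mapsto> z + 4\<close> sends \<open>s\<close> to \<open>s - 2\<close>, and
  the defining equation of \<^const>\<open>Qhat\<close> applies at the midpoint \<open>- z/2\<close>.
\<close>
lemma Qhat_Z_shift:
  "(1 + 2 * fps_X) * (shift 4 (shift (- 1) Qhat_Z) - shift (- 1) Qhat_Z) = 2 * fps_X\<^sup>2 * (1 + fps_X) * rhat_half"
proof -
  let ?r = "recip_affine (- 1 / 2) (0 :: rat)"
  have r: "?r = - (2 * fps_X)"
    by (simp add: recip_affine_0 numeral_fps_const)
  have r0: "?r $ 0 = 0"
    by simp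
  have 1: "shift (- 1) Qhat_Z = (Qhat oo recip_affine 1 1) oo ?r"
    unfolding Qhat_Z_def by (simp add: fps_compose_recip_affine shift_compose_recip_affine)
  have 2: "shift 4 (shift (- 1) Qhat_Z) = (Qhat oo recip_affine 1 (- 1)) oo ?r"
    unfolding Qhat_Z_def by (simp add: fps_compose_recip_affine shift_shift shift_compose_recip_affine)
  have "shift 4 (shift (- 1) Qhat_Z) - shift (- 1) Qhat_Z = - (fhat oo ?r)"
    unfolding Qhat_eq[symmetric] 2 unfolding 1 by (simp add: fps_compose_sub_distrib)
  moreover have "(4 * (1 - fps_X) * fhat) oo ?r = - (fps_X\<^sup>2 * (2 - fps_X) * rhat) oo ?r"
    by (simp only: fhat_mult)
  then have "4 * (1 - ?r) * (fhat oo ?r) = - (?r\<^sup>2 * (2 - ?r) * rhat_half)"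
    by (simp add: fps_compose_mult_distrib fps_compose_sub_distrib fps_compose_uminus power2_eq_square
          rhat_half_def fps_X_fps_compose_startby0[OF r0] flip: numeral_fps_const)
  then have "4 * ((1 + 2 * fps_X) * (fhat oo ?r)) = 4 * (- (2 * fps_X\<^sup>2 * (1 + fps_X) * rhat_half))"
    unfolding r by (simp add: power2_eq_square algebra_simps)
  then have "(1 + 2 * fps_X) * (fhat oo ?r) = - (2 * fps_X\<^sup>2 * (1 + fps_X) * rhat_half)"
    by (subst (asm) mult_left_cancel) (simp_all add: numeral_fps_const)
  ultimately show ?thesis
    by simp
qed

lemma rhat_half_mult_shift: "(1 + 2 * fps_X) * (rhat_half * shift 2 rhat_half) = 4"
proof -
  let ?r = "recip_affine (- 1 / 2) (0 :: rat)"
  have r: "?r = - (2 * fps_X)"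
    by (simp add: recip_affine_0 numeral_fps_const)
  have r0: "?r $ 0 = 0"
    by simp
  have "shift (- 1) rhat oo ?r = shift 2 rhat_half"
    by (simp add: rhat_half_def shift_compose_recip_affine_left shift_compose_recip_affine)
  moreover have "(1 - fps_X) * (rhat * shift (- 1) rhat) oo ?r = 4 oo ?r"
    by (simp only: rhat_mult_shift)
  ultimately have "(1 - ?r) * (rhat_half * shift 2 rhat_half) = 4"
    by (simp add: fps_compose_mult_distrib fps_compose_sub_distrib numeral_fps_const
          rhat_half_def)
  then show ?thesis
    unfolding r by simp
qed

section \<open>The formal Mellin transform\<close>

text \<open>The expansion of \<open>1 / ((Z-1)\<cdots>(Z-n)) = \<Gamma>(Z-n) / \<Gamma>(Z)\<close>.\<close>
definition mellin_kernel :: "nat \<Rightarrow> complex fps" where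
  "mellin_kernel n = (\<Prod>j=1..n. recip_affine 1 (- of_nat j))"

text \<open>
  Formally \<open>1/\<Gamma>(Z)\<close> times the integral of \<open>x\<^sup>Z\<^sup>-\<^sup>1 exp (- x) f(1/x)\<close> over \<open>x > 0\<close>; the indeterminate of \<open>f\<close> is
  \<open>1/x\<close>, that of the result \<open>1/Z\<close>.
\<close>
definition mellin :: "complex fps \<Rightarrow> complex fps" where
  "mellin f = Abs_fps (\<lambda>m. (\<Sum>n\<le>m. fps_const (f $ n) * mellin_kernel n) $ m)"

lemma mellin_kernel_0: "mellin_kernel 0 = 1"
  by (simp add: mellin_kernel_def)

lemma mellin_kernel_Suc: "mellin_kernel (Suc n) = recip_affine 1 (-1) * shift (- 1) (mellin_kernel n)"
proof -
  have "mellin_kernel (Suc n) = (\<Prod>j=0..n. recip_affine 1 (- of_nat (Suc j)))"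
    unfolding mellin_kernel_def One_nat_def by (simp only: prod.atLeast_Suc_atMost_Suc_shift) simp
  also have "\<dots> = recip_affine 1 (-1) * (\<Prod>j=1..n. recip_affine 1 (- of_nat (Suc j)))"
    by (subst prod.atLeast_Suc_atMost) simp_all
  also have "(\<Prod>j=1..n. recip_affine 1 (- of_nat (Suc j))) = shift (- 1) (mellin_kernel n)"
    by (simp add: mellin_kernel_def shift_def fps_compose_prod_distrib recip_affine_compose)
  finally show ?thesis .
qed

lemma mellin_kernel_nth_eq_0: "m < n \<Longrightarrow> mellin_kernel n $ m = 0"
proof (induction n arbitrary: m)
  case (Suc n)
  have *: "(\<Prod>j=1..Suc n. recip_affine 1 (- of_nat j :: complex)) = mellin_kernel n * recip_affine 1 (- of_nat (Suc n))"
    by (simp add: mellin_kernel_def)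
  have "mellin_kernel (Suc n) $ m = (\<Sum>i=0..m. mellin_kernel n $ i * recip_affine 1 (- of_nat (Suc n)) $ (m - i))"
    unfolding mellin_kernel_def[of "Suc n"] * by (simp add: fps_mult_nth)
  also have "\<dots> = 0"
  proof (rule sum.neutral, safe)
    fix i assume "i \<in> {0..m}"
    then consider "i < n" | "i = m" using Suc.prems by fastforce
    then show "mellin_kernel n $ i * recip_affine 1 (- of_nat (Suc n)) $ (m - i) = 0"
      by cases (use Suc.IH in auto)
  qed
  finally show ?case .
qed simp

lemma mellin_nth: "m \<le> N \<Longrightarrow> mellin f $ m = (\<Sum>n\<le>N. f $ n * mellin_kernel n $ m)"
  unfolding mellin_def
  by (simp add: fps_sum_nth) (intro sum.mono_neutral_left; simp add: mellin_kernel_nth_eq_0)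

lemma mellin_add: "mellin (f + h) = mellin f + mellin h"
  and mellin_diff: "mellin (f - h) = mellin f - mellin h"
  and mellin_const_mult: "mellin (fps_const c * f) = fps_const c * mellin f"
  by (simp_all add: fps_eq_iff mellin_nth[OF order_refl] sum.distrib sum_subtractf algebra_simps sum_distrib_left)

lemma shift_mellin_nth: "m \<le> N \<Longrightarrow> shift c (mellin f) $ m = (\<Sum>n\<le>N. f $ n * shift c (mellin_kernel n) $ m)"
proof -
  assume "m \<le> N"
  have "shift c (mellin f) $ m = (\<Sum>i=0..m. (\<Sum>n\<le>N. f $ n * mellin_kernel n $ i) * (recip_affine 1 c ^ i) $ m)"
    unfolding shift_def fps_compose_nth
    by (intro sum.cong refl arg_cong2[where f = "(*)"] mellin_nth) (use \<open>m \<le> N\<close> in auto)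
  also have "\<dots> = (\<Sum>n\<le>N. f $ n * shift c (mellin_kernel n) $ m)"
    unfolding shift_def fps_compose_nth sum_distrib_left sum_distrib_right
    by (subst sum.swap) (simp add: mult.assoc)
  finally show ?thesis .
qed

text \<open>Multiplication by \<open>1/x\<close> lowers \<open>Z\<close> by one; the factor \<open>1/(Z-1)\<close> is \<open>\<Gamma>(Z-1) / \<Gamma>(Z)\<close>.\<close>
lemma mellin_X_mult: "mellin (fps_X * f) = recip_affine 1 (- 1) * shift (- 1) (mellin f)"
proof (rule fps_ext)
  fix m
  have "mellin (fps_X * f) $ m = (\<Sum>n\<le>Suc m. (fps_X * f) $ n * mellin_kernel n $ m)"
    by (rule mellin_nth) simp
  also have "\<dots> = (\<Sum>n\<le>m. f $ n * mellin_kernel (Suc n) $ m)"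
    by (simp only: sum.atMost_Suc_shift) simp
  also have "\<dots> = (\<Sum>n\<le>m. f $ n * (\<Sum>i=0..m. recip_affine 1 (- 1) $ i * shift (- 1) (mellin_kernel n) $ (m - i)))"
    by (simp add: mellin_kernel_Suc fps_mult_nth)
  also have "\<dots> = (\<Sum>i=0..m. recip_affine 1 (- 1) $ i * (\<Sum>n\<le>m. f $ n * shift (- 1) (mellin_kernel n) $ (m - i)))"
    unfolding sum_distrib_left by (subst sum.swap) (simp add: mult_ac)
  also have "\<dots> = (recip_affine 1 (- 1) * shift (- 1) (mellin f)) $ m"
    unfolding fps_mult_nth by (intro sum.cong refl) (simp add: shift_mellin_nth[of _ m])
  finally show "mellin (fps_X * f) $ m = (recip_affine 1 (- 1) * shift (- 1) (mellin f)) $ m" .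
qed

text \<open>
  The case \<open>f = t\<^sup>n\<close> of the integration by parts below:
  \<open>1/((Z-2)\<cdots>(Z-n-1)) - 1/((Z-1)\<cdots>(Z-n)) = n / ((Z-1)\<cdots>(Z-n-1))\<close>.
\<close>
lemma shift_mellin_kernel: "shift (- 1) (mellin_kernel n) = mellin_kernel n + fps_const (of_nat n) * mellin_kernel (Suc n)"
proof (cases n)
  case 0
  then show ?thesis by (simp add: mellin_kernel_0 shift_1)
next
  case (Suc k)
  let ?s = "shift (- 1) (mellin_kernel k)"
  have *: "mellin_kernel (Suc n) = mellin_kernel n * recip_affine 1 (- of_nat (Suc n))"
    by (simp add: mellin_kernel_def)
  then have "recip_affine 1 (- 1) * shift (- 1) (mellin_kernel n) = recip_affine 1 (- 1) * (?s * recip_affine 1 (- of_nat (Suc n)))"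
    by (simp add: mellin_kernel_Suc Suc mult.assoc)
  moreover have "recip_affine 1 (- 1) \<noteq> (0 :: complex fps)"
    using recip_affine_1_mult[of "-1 :: complex"] by (metis fps_X_neq_zero mult_zero_left)
  ultimately have "shift (- 1) (mellin_kernel n) = ?s * recip_affine 1 (- of_nat (Suc n))"
    by (metis mult_left_cancel)
  also have "\<dots> = ?s * (recip_affine 1 (- 1)
      + fps_const (of_nat n) * recip_affine 1 (- of_nat (Suc n)) * recip_affine 1 (- 1))"
    using recip_affine_diff[of "- of_nat (Suc n) :: complex" "- 1"]
    by (intro arg_cong2[where f = "(*)"] refl) (simp add: algebra_simps)
  also have "\<dots> = recip_affine 1 (- 1) * ?s
      + fps_const (of_nat n) * (recip_affine 1 (- 1) * ?s * recip_affine 1 (- of_nat (Suc n)))"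
    by (simp only: distrib_left mult_ac)
  also have "recip_affine 1 (- 1) * ?s = mellin_kernel n"
    by (simp add: Suc mellin_kernel_Suc)
  finally show ?thesis
    unfolding * .
qed

text \<open>
  Integration by parts: in \<open>t = 1/x\<close> the operator \<open>t\<^sup>2 d/dt\<close> is \<open>- d/dx\<close>, and the derivative falls on
  \<open>x\<^sup>Z\<^sup>-\<^sup>1 exp (- x)\<close>.
\<close>
lemma mellin_euler: "mellin (fps_X\<^sup>2 * fps_deriv f) = shift (- 1) (mellin f) - mellin f"
proof (rule fps_ext)
  fix m
  have "mellin (fps_X\<^sup>2 * fps_deriv f) $ m = (\<Sum>n\<le>Suc m. (fps_X\<^sup>2 * fps_deriv f) $ n * mellin_kernel n $ m)"
    by (rule mellin_nth) simp
  also have "\<dots> = (\<Sum>n\<le>m. f $ n * (of_nat n * mellin_kernel (Suc n) $ m))"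
    by (simp only: sum.atMost_Suc_shift)
       (auto simp: fps_X_power_mult_nth Suc_diff_Suc intro!: sum.cong)
  also have "\<dots> = (\<Sum>n\<le>m. f $ n * (shift (- 1) (mellin_kernel n) $ m - mellin_kernel n $ m))"
    by (simp add: shift_mellin_kernel)
  also have "\<dots> = (shift (- 1) (mellin f) - mellin f) $ m"
    by (simp add: shift_mellin_nth[of m m] mellin_nth[of m m] sum_subtractf right_diff_distrib)
  finally show "mellin (fps_X\<^sup>2 * fps_deriv f) $ m = (shift (- 1) (mellin f) - mellin f) $ m" .
qed

section \<open>The Bessel amplitudes and the recurrence in Z\<close>

text \<open>
  Here \<open>N = \<nu>\<^sup>2\<close> and the indeterminate is \<open>t = 1/x\<close>: formally \<open>K\<^sub>\<nu>(x/p)\<close> is a constant times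
  \<open>x\<^sup>-\<^sup>1\<^sup>/\<^sup>2 exp (- x/p)\<close> times this series.
\<close>
definition amplitude :: "complex \<Rightarrow> complex \<Rightarrow> complex fps" where
  "amplitude N p = Abs_fps (\<lambda>k. acoeff k N * p ^ k)"

lemma acoeff_Suc: "8 * of_nat (Suc k) * acoeff (Suc k) N = (4 * N - (2 * of_nat k + 1)\<^sup>2) * acoeff k N"
proof -
  have "of_nat (Suc k) \<noteq> (0::complex)"
    by (simp del: of_nat_Suc)
  then show ?thesis
    unfolding acoeff_def fact_Suc by (simp del: of_nat_Suc add: field_simps)
qed

text \<open>
  Bessel's equation for the amplitude. In terms of the Euler operator \<open>\<theta> = t d/dt\<close> it is
  \<open>2 U' = p (N - (\<theta> + 1/2)\<^sup>2) U\<close>, which is the recursion of the coefficients.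
\<close>
lemma amplitude_ode:
  "2 * fps_deriv (amplitude N p) = fps_const p * (fps_const N * amplitude N p - fps_const (1 / 4) * amplitude N p
     - 2 * (fps_X * fps_deriv (amplitude N p)) - fps_X\<^sup>2 * fps_deriv (fps_deriv (amplitude N p)))"
proof (rule fps_ext)
  fix k
  let ?U = "amplitude N p" and ?k = "of_nat k :: complex"
  have "(2 * fps_deriv ?U) $ k = (8 * of_nat (Suc k) * acoeff (Suc k) N) * p ^ Suc k / 4"
    by (simp add: amplitude_def numeral_fps_const)
  also have "\<dots> = p * (N * ?U $ k - 1 / 4 * ?U $ k - 2 * (?k * ?U $ k) - ?k * (?k - 1) * ?U $ k)"
    unfolding acoeff_Suc by (simp add: amplitude_def power2_eq_square algebra_simps add_divide_distrib diff_divide_distrib)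
  also have "?k * (?k - 1) * ?U $ k = (fps_X\<^sup>2 * fps_deriv (fps_deriv ?U)) $ k"
  proof -
    consider "k = 0" | "k = 1" | n where "k = Suc (Suc n)"
      by (metis One_nat_def not0_implies_Suc)
    then show ?thesis
    proof cases
      case 3
      then show ?thesis
        by (simp add: fps_X_power_mult_nth)
    qed (simp_all add: fps_X_power_mult_nth)
  qed
  also have "?k * ?U $ k = (fps_X * fps_deriv ?U) $ k"
    by (cases k) simp_all
  finally show "(2 * fps_deriv ?U) $ k = (fps_const p * (fps_const N * ?U - fps_const (1 / 4) * ?U
     - 2 * (fps_X * fps_deriv ?U) - fps_X\<^sup>2 * fps_deriv (fps_deriv ?U))) $ k"
    by (simp add: numeral_fps_const)
qed

text \<open>
  The amplitude of \<open>- x d/dx\<close> applied to \<open>K\<^sub>\<nu>(x/p)\<close>, divided by \<open>x\<close> to obtain a power series in \<open>1/x\<close>.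
\<close>
definition amplitude' :: "complex \<Rightarrow> complex \<Rightarrow> complex fps" where
  "amplitude' N p = fps_const (1 / p) * amplitude N p + fps_X\<^sup>2 * fps_deriv (amplitude N p)
     + fps_const (1 / 2) * fps_X * amplitude N p"

text \<open>Together with the definition of \<^const>\<open>amplitude'\<close>, Bessel's equation as a first-order system.\<close>
lemma amplitude'_deriv:
  assumes "p \<noteq> 0"
  shows "fps_X\<^sup>2 * fps_deriv (amplitude' N p) = (fps_const ((1 / p)\<^sup>2) + fps_const N * fps_X\<^sup>2) * amplitude N p
     - fps_const (1 / p) * amplitude' N p + fps_const (1 / 2) * fps_X * amplitude' N p"
proof -
  define U where "U = amplitude N p"
  define h R where "h = (fps_const (1 / 2) :: complex fps)" and "R = fps_const (1 / p)"
  have h: "2 * h = 1" "fps_const (1 / 4) = h * h"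
    by (simp_all add: h_def numeral_fps_const)
  have "R * (2 * fps_deriv U) = (R * fps_const p) * (fps_const N * U - h * h * U - 2 * (fps_X * fps_deriv U) - fps_X\<^sup>2 * fps_deriv (fps_deriv U))"
    unfolding U_def amplitude_ode h(2)[symmetric] by (simp only: mult.assoc)
  also have "R * fps_const p = 1"
    using assms by (simp add: R_def)
  finally have E: "fps_X\<^sup>2 * fps_deriv (fps_deriv U) = fps_const N * U - h * h * U - 2 * (fps_X * fps_deriv U) - 2 * (R * fps_deriv U)"
    by (simp add: algebra_simps)
  have hU: "h * U = 2 * (h * h) * U"
    using h(1) by (metis mult.assoc mult_1)
  have U': "amplitude' N p = R * U + fps_X\<^sup>2 * fps_deriv U + h * fps_X * U"
    by (simp add: amplitude'_def U_def R_def h_def)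
  have "fps_deriv (amplitude' N p) = R * fps_deriv U + 2 * (fps_X * fps_deriv U) + fps_X\<^sup>2 * fps_deriv (fps_deriv U) + h * U + h * fps_X * fps_deriv U"
    unfolding U' by (simp add: R_def h_def power2_eq_square algebra_simps)
  also have "\<dots> = fps_const N * U + h * h * U - R * fps_deriv U + h * fps_X * fps_deriv U"
    unfolding E hU by (simp add: algebra_simps)
  finally have D: "fps_deriv (amplitude' N p)
      = fps_const N * U + h * h * U - R * fps_deriv U + h * fps_X * fps_deriv U" .
  show ?thesis
    unfolding D unfolding U' U_def[symmetric] h_def[symmetric]
    by (simp add: algebra_simps power2_eq_square R_def)
qed

lemma amplitude_deriv:
  "fps_X\<^sup>2 * fps_deriv (amplitude N p) = amplitude' N p - fps_const (1 / p) * amplitude N p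
     - fps_const (1 / 2) * fps_X * amplitude N p"
  by (simp add: amplitude'_def)

text \<open>
  For the amplitudes \<open>U\<close>, \<open>V\<close> with companions \<open>U1\<close>, \<open>V1\<close>, the product \<open>U V\<close>, the sum and the difference of the mixed products, and \<open>U1 V1\<close> form a closed system. The condition
  \<open>R + Q = 1\<close> makes every left side with the zeroth-order term moved over equal to \<open>t\<^sup>2 d/dt + 1\<close>, whose transform is a
  pure shift; the condition \<open>R\<^sup>2 + Q\<^sup>2 = 0\<close> removes the product from the leading terms of the equation for the sum.
\<close>
lemma amplitude_product_system:
  fixes X h R Q a b U U1 V V1 U' U1' V' V1' :: "'r::comm_ring_1"
  assumes "X\<^sup>2 * U' = U1 - R * U - h * X * U" "X\<^sup>2 * U1' = (R\<^sup>2 + a * X\<^sup>2) * U - R * U1 + h * X * U1"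
    and "X\<^sup>2 * V' = V1 - Q * V - h * X * V" "X\<^sup>2 * V1' = (Q\<^sup>2 + b * X\<^sup>2) * V - Q * V1 + h * X * V1"
    and "R + Q = 1" "h + h = 1" "R\<^sup>2 + Q\<^sup>2 = 0"
  shows "X\<^sup>2 * (U' * V + U * V') = (U1 * V + U * V1) - U * V - X * (U * V)"
    and "X\<^sup>2 * ((U1' * V + U1 * V') + (U' * V1 + U * V1'))
      = (a + b) * (X\<^sup>2 * (U * V)) + 2 * (U1 * V1) - (U1 * V + U * V1)"
    and "X\<^sup>2 * ((U' * V1 + U * V1') - (U1' * V + U1 * V'))
      = 2 * Q\<^sup>2 * (U * V) + (b - a) * (X\<^sup>2 * (U * V)) - (U * V1 - U1 * V)"
    and "X\<^sup>2 * (U1' * V1 + U1 * V1') = - (Q\<^sup>2 * (U * V1 - U1 * V))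
      + X\<^sup>2 * (a * (U * V1) + b * (U1 * V)) - U1 * V1 + X * (U1 * V1)"
proof -
  have R: "R = 1 - Q" and R2: "R\<^sup>2 = - Q\<^sup>2"
    using assms by (simp_all add: algebra_simps eq_neg_iff_add_eq_0)
  have hh: "h * y + h * y = y" "h * y + (h * y + z) = y + z" for y z
    by (metis assms(6) distrib_right mult_1) (metis assms(6) distrib_right mult_1 add.assoc)
  have h2: "h * 2 = 1"
    using assms(6) by (simp flip: mult_2_right)
  have e1: "X\<^sup>2 * (f' * k + f * k') = (X\<^sup>2 * f') * k + f * (X\<^sup>2 * k')" for f' k f k'
    by (simp add: algebra_simps)
  show "X\<^sup>2 * (U' * V + U * V') = (U1 * V + U * V1) - U * V - X * (U * V)"
    unfolding e1 assms(1,3) R by (simp add: algebra_simps hh h2)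
  show "X\<^sup>2 * ((U1' * V + U1 * V') + (U' * V1 + U * V1'))
      = (a + b) * (X\<^sup>2 * (U * V)) + 2 * (U1 * V1) - (U1 * V + U * V1)"
    unfolding distrib_left[of "X\<^sup>2" "U1' * V + U1 * V'"] e1 assms(1-4) R2 unfolding R by (simp add: algebra_simps hh h2)
  show "X\<^sup>2 * ((U' * V1 + U * V1') - (U1' * V + U1 * V'))
      = 2 * Q\<^sup>2 * (U * V) + (b - a) * (X\<^sup>2 * (U * V)) - (U * V1 - U1 * V)"
    unfolding right_diff_distrib[of "X\<^sup>2" "U' * V1 + U * V1'"] e1 assms(1-4) R2 unfolding R by (simp add: algebra_simps hh h2)
  show "X\<^sup>2 * (U1' * V1 + U1 * V1') = - (Q\<^sup>2 * (U * V1 - U1 * V))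
      + X\<^sup>2 * (a * (U * V1) + b * (U1 * V)) - U1 * V1 + X * (U1 * V1)"
    unfolding e1 assms(1-4) R2 unfolding R by (simp add: algebra_simps hh h2)
qed

text \<open>
  The linear algebra behind the recurrence. \<open>W1\<close>, \<open>W3\<close> and \<open>Wm\<close> are the transform of \<open>U V\<close> shifted by
  \<open>1\<close>, \<open>3\<close> and \<open>-1\<close>; \<open>S0\<close>, \<open>T0\<close>, \<open>T2\<close> and \<open>Y1\<close> are shifted transforms of the other components of the product system; \<open>X\<close> is \<open>1/z\<close>, and \<open>r1\<close>, \<open>r2\<close>, \<open>rm\<close> stand for \<open>1/(z+1)\<close>, \<open>1/(z+2)\<close> and \<open>1/(z-1)\<close>. All components but the product
  are eliminated after clearing these three denominators.
\<close>
lemma companion_elimination: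
  fixes X I s d S0 T0 T2 Y1 W1 W3 Wm r1 r2 rm :: "'r::idom"
  assumes "S0 = (1 + rm) * Wm" "S0 = s * (X * rm * Wm) + 2 * Y1"
    "2 * Y1 = - I * T2 + s * (r1 * X * S0) + d * (r1 * X * T0) + 2 * r1 * Y1"
    "T2 = I * W3 - d * (r2 * r1 * W1)" "T0 = I * W1 - d * (X * rm * Wm)"
    "r1 * (1 + X) = X" "r2 * (1 + 2 * X) = X" "rm * (1 - X) = X" "I * I = -1"
  shows "(1 + 2 * X) * (1 - 2 * s * X^2 + d^2 * X^4) * Wm
      = (1 - X^2) * ((1 + 2 * X) * W3 + 2 * I * d * X^2 * W1)"
proof -
  have rm: "(1 - X) * rm = X" "(1 + X) * r1 = X" "(1 + 2 * X) * r2 = X"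
    using assms by (simp_all add: mult.commute)
  have S0: "(1 - X) * S0 = Wm"
  proof -
    have "(1 - X) * S0 = (1 - X) * Wm + (1 - X) * rm * Wm"
      unfolding assms(1) by (simp add: algebra_simps)
    then show ?thesis
      unfolding rm(1) by (simp add: algebra_simps)
  qed
  have Y1: "(1 - X) * (2 * Y1) = (1 - s * X^2) * Wm"
  proof -
    have "(1 - X) * (2 * Y1) = (1 - X) * S0 - s * X * ((1 - X) * rm) * Wm"
      unfolding assms(2) by (simp add: algebra_simps)
    then show ?thesis
      unfolding rm(1) S0 by (simp add: algebra_simps power2_eq_square)
  qed
  have T0: "(1 - X) * T0 = (1 - X) * I * W1 - d * X^2 * Wm"
  proof -
    have "(1 - X) * T0 = (1 - X) * I * W1 - d * X * ((1 - X) * rm) * Wm"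
      unfolding assms(5) by (simp add: algebra_simps)
    then show ?thesis
      unfolding rm(1) by (simp add: algebra_simps power2_eq_square)
  qed
  have T2: "(1 + X) * (1 + 2 * X) * (I * T2) = - ((1 + X) * (1 + 2 * X) * W3) - I * d * X^2 * W1"
  proof -
    have "(1 + X) * (1 + 2 * X) * (I * T2) = (I * I) * ((1 + X) * (1 + 2 * X) * W3)
        - I * d * (((1 + X) * r1) * ((1 + 2 * X) * r2)) * W1"
      unfolding assms(4) by (simp add: algebra_simps)
    then show ?thesis
      unfolding rm assms(9) by (simp add: power2_eq_square)
  qed
  have 1: "2 * Y1 = - (1 + X) * (I * T2) + s * X^2 * S0 + d * X^2 * T0"
  proof -
    have "(1 + X) * (2 * Y1) = - (1 + X) * (I * T2) + s * (X * ((1 + X) * r1) * S0)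
        + d * (X * ((1 + X) * r1) * T0) + 2 * ((1 + X) * r1) * Y1"
      by (subst assms(3)) (simp add: algebra_simps)
    then show ?thesis
      unfolding rm by (simp add: algebra_simps power2_eq_square)
  qed
  have "(1 + 2 * X) * ((1 - X) * (2 * Y1)) = - (1 - X) * ((1 + X) * (1 + 2 * X) * (I * T2))
      + (1 + 2 * X) * (s * X^2 * ((1 - X) * S0) + d * X^2 * ((1 - X) * T0))"
    unfolding 1 by (simp add: algebra_simps)
  then show ?thesis
    unfolding S0 Y1 T0 T2 by (simp add: algebra_simps power2_eq_square power4_eq_xxxx)
qed

lemma Fseries_eq_mellin: "Fseries A B = mellin (amplitude A (1 + \<i>) * amplitude B (1 - \<i>))"
proof -
  have "Gcoeff n A B = (amplitude A (1 + \<i>) * amplitude B (1 - \<i>)) $ n" for n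
    by (simp add: Gcoeff_def fps_mult_nth amplitude_def atLeast0AtMost mult_ac)
  then show ?thesis
    by (simp add: Fseries_def mellin_def mellin_kernel_def)
qed

lemma mellin_X2_mult:
  "mellin (fps_X\<^sup>2 * f) = recip_affine 1 (- 1) * (recip_affine 1 (- 2) * shift (- 2) (mellin f))"
  by (simp add: power2_eq_square mult.assoc mellin_X_mult shift_mult shift_recip_affine shift_shift)

text \<open>
  The transform of the product system, with the companion components eliminated. The variable of the series is
  \<open>z = Z + 1\<close>, so \<open>F(Z)\<close>, \<open>F(Z+2)\<close> and \<open>F(Z+4)\<close> appear as shifts by \<open>-1\<close>, \<open>1\<close> and \<open>3\<close>.
\<close>
lemma Fseries_recurrence:
  fixes A B :: complex
  defines "s \<equiv> fps_const (A + B)" and "d \<equiv> fps_const (A - B)" and "X \<equiv> fps_X"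
    and "F \<equiv> Fseries A B"
  shows "(1 + 2 * X) * (1 - 2 * s * X ^ 2 + d\<^sup>2 * X ^ 4) * shift (- 1) F
       = (1 - X\<^sup>2) * ((1 + 2 * X) * shift 3 F + 2 * fps_const \<i> * d * X\<^sup>2 * shift 1 F)"
proof -
  define p q where "p = 1 + \<i>" and "q = 1 - \<i>"
  have pq: "p \<noteq> 0" "q \<noteq> 0"
    by (auto simp: p_def q_def complex_eq_iff)
  have inv: "1 / p = (1 - \<i>) / 2" "1 / q = (1 + \<i>) / 2"
    by (simp_all add: p_def q_def complex_eq_iff Re_divide Im_divide)
  define U U1 where "U = amplitude A p" and "U1 = amplitude' A p"
  define V V1 where "V = amplitude B q" and "V1 = amplitude' B q"
  have Q2: "(1 / q)\<^sup>2 = \<i> / 2" "(1 / p)\<^sup>2 = - (\<i> / 2)"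
    unfolding inv by (simp_all add: power2_eq_square complex_eq_iff)
  have sys:
    "fps_X\<^sup>2 * fps_deriv (U * V) = (U1 * V + U * V1) - U * V - fps_X * (U * V)"
    "fps_X\<^sup>2 * fps_deriv (U1 * V + U * V1) = s * (fps_X\<^sup>2 * (U * V)) + fps_const 2 * (U1 * V1) - (U1 * V + U * V1)"
    "fps_X\<^sup>2 * fps_deriv (U * V1 - U1 * V) = fps_const \<i> * (U * V) - d * (fps_X\<^sup>2 * (U * V)) - (U * V1 - U1 * V)"
    "fps_X\<^sup>2 * fps_deriv (U1 * V1) = fps_const (- \<i> / 2) * (U * V1 - U1 * V)
       + fps_const (1 / 2) * (s * (fps_X\<^sup>2 * (U1 * V + U * V1)) + d * (fps_X\<^sup>2 * (U * V1 - U1 * V))) - U1 * V1 + fps_X * (U1 * V1)"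
  proof -
    note eqs = amplitude_product_system[of fps_X "fps_deriv U" U1 "fps_const (1 / p)" U "fps_const (1 / 2)" "fps_deriv U1"
      "fps_const A" "fps_deriv V" V1 "fps_const (1 / q)" V "fps_deriv V1" "fps_const B"]
    have 1: "fps_X\<^sup>2 * fps_deriv U = U1 - fps_const (1 / p) * U - fps_const (1 / 2) * fps_X * U"
      "fps_X\<^sup>2 * fps_deriv V = V1 - fps_const (1 / q) * V - fps_const (1 / 2) * fps_X * V"
      unfolding U_def U1_def V_def V1_def by (rule amplitude_deriv)+
    have 2: "fps_X\<^sup>2 * fps_deriv U1 = ((fps_const (1 / p))\<^sup>2 + fps_const A * fps_X\<^sup>2) * U - fps_const (1 / p) * U1 + fps_const (1 / 2) * fps_X * U1"
      "fps_X\<^sup>2 * fps_deriv V1 = ((fps_const (1 / q))\<^sup>2 + fps_const B * fps_X\<^sup>2) * V - fps_const (1 / q) * V1 + fps_const (1 / 2) * fps_X * V1"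
      unfolding U_def U1_def V_def V1_def fps_const_power by (intro amplitude'_deriv pq)+
    have 3: "fps_const (1 / p) + fps_const (1 / q) = 1" "fps_const (1 / 2) + fps_const (1 / 2) = (1 :: complex fps)"
      "(fps_const (1 / p))\<^sup>2 + (fps_const (1 / q))\<^sup>2 = 0"
      unfolding fps_const_power Q2 by (simp_all add: inv field_simps)
    note eqs = eqs[OF 1(1) 2(1) 1(2) 2(2) 3]
    have c: "2 * (fps_const (1 / q))\<^sup>2 = fps_const \<i>" "(fps_const (1 / q))\<^sup>2 = fps_const (\<i> / 2)"
      "fps_const B - fps_const A = - d" "fps_const A + fps_const B = s"
      unfolding fps_const_power Q2 by (simp_all add: numeral_fps_const s_def d_def)
    show "fps_X\<^sup>2 * fps_deriv (U * V) = (U1 * V + U * V1) - U * V - fps_X * (U * V)"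
      using eqs(1) by (simp add: add.commute)
    show "fps_X\<^sup>2 * fps_deriv (U1 * V + U * V1) = s * (fps_X\<^sup>2 * (U * V)) + fps_const 2 * (U1 * V1) - (U1 * V + U * V1)"
      using eqs(2) unfolding c(4) by (simp add: add_ac numeral_fps_const)
    show "fps_X\<^sup>2 * fps_deriv (U * V1 - U1 * V) = fps_const \<i> * (U * V) - d * (fps_X\<^sup>2 * (U * V)) - (U * V1 - U1 * V)"
      using eqs(3) unfolding c(1,3) by (simp add: add_ac)
    have ab: "a * f + b * k = fps_const (1 / 2) * ((a + b) * (k + f) + (a - b) * (f - k))" for a b f k :: "complex fps"
    proof -
      have "fps_const (1 / 2) * ((a + b) * (k + f) + (a - b) * (f - k)) = fps_const (1 / 2) * (fps_const 2 * (a * f + b * k))"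
        by (simp add: algebra_simps flip: numeral_fps_const)
      also have "\<dots> = a * f + b * k"
        by (simp only: mult.assoc[symmetric] fps_const_mult) simp
      finally show ?thesis by simp
    qed
    have d: "fps_const A - fps_const B = d"
      by (simp add: d_def)
    have ab': "fps_const A * (U * V1) + fps_const B * (U1 * V)
        = fps_const (1 / 2) * (s * (U1 * V + U * V1) + d * (U * V1 - U1 * V))"
      using ab[of "fps_const A" "U * V1" "fps_const B" "U1 * V"] unfolding c(4) d .
    have "fps_X\<^sup>2 * fps_deriv (U1 * V1) = - (fps_const (\<i> / 2) * (U * V1 - U1 * V))
      + fps_X\<^sup>2 * (fps_const (1 / 2) * (s * (U1 * V + U * V1) + d * (U * V1 - U1 * V))) - U1 * V1 + fps_X * (U1 * V1)"
      using eqs(4) unfolding ab' c by (simp add: add_ac)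
    moreover have "fps_const (- \<i> / 2) = - fps_const (\<i> / 2)"
      by simp
    ultimately show "fps_X\<^sup>2 * fps_deriv (U1 * V1) = fps_const (- \<i> / 2) * (U * V1 - U1 * V)
       + fps_const (1 / 2) * (s * (fps_X\<^sup>2 * (U1 * V + U * V1)) + d * (fps_X\<^sup>2 * (U * V1 - U1 * V))) - U1 * V1 + fps_X * (U1 * V1)"
      by (simp only:) (simp add: algebra_simps del: fps_const_neg)
  qed
  define W S T Y where "W = mellin (U * V)" and "S = mellin (U1 * V + U * V1)"
    and "T = mellin (U * V1 - U1 * V)" and "Y = mellin (U1 * V1)"
  have 1: "shift (- 1) W - W = S - W - recip_affine 1 (- 1) * shift (- 1) W"
    using arg_cong[OF sys(1), of mellin]
    unfolding mellin_euler mellin_diff mellin_X_mult W_def[symmetric] S_def[symmetric] .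
  have 2: "shift (- 1) S - S = s * (recip_affine 1 (- 1) * (recip_affine 1 (- 2) * shift (- 2) W)) + fps_const 2 * Y - S"
    using arg_cong[OF sys(2), of mellin]
    unfolding mellin_euler unfolding mellin_diff mellin_add[of _ "fps_const 2 * (U1 * V1)"] mellin_X2_mult
      W_def[symmetric] S_def[symmetric] Y_def[symmetric] mellin_const_mult s_def .
  have 3: "shift (- 1) T - T = fps_const \<i> * W - d * (recip_affine 1 (- 1) * (recip_affine 1 (- 2) * shift (- 2) W)) - T"
    using arg_cong[OF sys(3), of mellin]
    unfolding mellin_euler unfolding T_def[symmetric] mellin_diff[of _ "U * V1 - U1 * V"] mellin_diff[of "fps_const \<i> * _"]
     mellin_X2_mult W_def[symmetric] mellin_const_mult d_def .
  have 4: "shift (- 1) Y - Y = fps_const (- \<i> / 2) * T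
      + fps_const (1 / 2) * (s * (recip_affine 1 (- 1) * (recip_affine 1 (- 2) * shift (- 2) S))
      + d * (recip_affine 1 (- 1) * (recip_affine 1 (- 2) * shift (- 2) T))) - Y + recip_affine 1 (- 1) * shift (- 1) Y"
    using arg_cong[OF sys(4), of mellin]
    unfolding mellin_euler unfolding Y_def[symmetric] mellin_X_mult mellin_add[of _ "fps_X * (U1 * V1)"] mellin_diff[of _ "U1 * V1"]
      mellin_add[of "fps_const (- \<i> / 2) * _"] mellin_const_mult s_def d_def mellin_add[of "fps_const (A + B) * (fps_X\<^sup>2 * _)"]
      T_def[symmetric] mellin_X2_mult S_def[symmetric] .
  note shift_simps = shift_hom shift_recip_affine shift_shift shift_0 recip_affine_1_0 s_def d_def
  have W: "W = F"
    by (simp add: W_def F_def Fseries_eq_mellin U_def V_def p_def q_def)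
  have "(1 + 2 * X) * (1 - 2 * s * X ^ 2 + d\<^sup>2 * X ^ 4) * shift (- 1) W
       = (1 - X\<^sup>2) * ((1 + 2 * X) * shift 3 W + 2 * fps_const \<i> * d * X\<^sup>2 * shift 1 W)"
  proof (rule companion_elimination[where ?S0.0 = S and ?Y1.0 = "shift 1 Y" and ?T2.0 = "shift 2 T" and ?T0.0 = T
        and ?r1.0 = "recip_affine 1 1" and ?r2.0 = "recip_affine 1 2" and rm = "recip_affine 1 (- 1)"])
    show "S = (1 + recip_affine 1 (- 1)) * shift (- 1) W"
      using 1 by (simp add: algebra_simps)
    show "S = s * (X * recip_affine 1 (- 1) * shift (- 1) W) + 2 * shift 1 Y"
      using arg_cong[OF 2, of "shift 1"] by (simp add: shift_simps X_def mult_ac numeral_fps_const)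
    show "shift 2 T = fps_const \<i> * shift 3 W - d * (recip_affine 1 2 * recip_affine 1 1 * shift 1 W)"
      using arg_cong[OF 3, of "shift 3"] by (simp add: shift_simps X_def mult_ac)
    show "T = fps_const \<i> * shift 1 W - d * (X * recip_affine 1 (- 1) * shift (- 1) W)"
      using arg_cong[OF 3, of "shift 1"] by (simp add: shift_simps X_def mult_ac)
    have "shift 1 Y = fps_const (- \<i> / 2) * shift 2 T
        + fps_const (1 / 2) * (s * (recip_affine 1 1 * X * S) + d * (recip_affine 1 1 * X * T))
        + recip_affine 1 1 * shift 1 Y"
      using arg_cong[OF 4, of "shift 2"] by (simp add: shift_simps X_def mult_ac add_ac)
    moreover have "2 * (fps_const (- \<i> / 2) * f + fps_const (1 / 2) * k + l) = - fps_const \<i> * f + k + 2 * l" for f k l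
    proof -
      have "2 * (fps_const (- \<i> / 2) * f) = - fps_const \<i> * f" "2 * (fps_const (1 / 2) * k) = k"
        by (simp_all add: numeral_fps_const flip: mult.assoc)
      then show ?thesis
        by (simp only: distrib_left)
    qed
    ultimately have "2 * shift 1 Y = - fps_const \<i> * shift 2 T
        + (s * (recip_affine 1 1 * X * S) + d * (recip_affine 1 1 * X * T)) + 2 * (recip_affine 1 1 * shift 1 Y)"
      by metis
    then show "2 * shift 1 Y = - fps_const \<i> * shift 2 T + s * (recip_affine 1 1 * X * S)
        + d * (recip_affine 1 1 * X * T) + 2 * recip_affine 1 1 * shift 1 Y"
      by (simp only: add.assoc mult.assoc)
    show "recip_affine 1 1 * (1 + X) = X"
      using recip_affine_1_mult[of "1 :: complex"] by (simp add: X_def)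
    show "recip_affine 1 2 * (1 + 2 * X) = X"
      using recip_affine_1_mult[of "2 :: complex"] by (simp add: X_def numeral_fps_const)
    show "recip_affine 1 (- 1) * (1 - X) = X"
      using recip_affine_1_mult[of "- 1 :: complex"] by (simp add: X_def flip: fps_const_neg)
    show "fps_const \<i> * fps_const \<i> = - 1"
      by (simp flip: fps_const_neg)
  qed
  then show ?thesis
    unfolding W .
qed

section \<open>The first-order variation at A = B = 0\<close>

text \<open>
  The coefficients of \<open>F\<close> and \<open>log F\<close> are polynomials in \<open>A\<close>, so the formal derivative in \<open>A\<close> may be taken coefficient by
  coefficient as a complex derivative.
\<close>
definition has_coeff_deriv :: "(complex \<Rightarrow> complex fps) \<Rightarrow> complex fps \<Rightarrow> bool" where
  "has_coeff_deriv f f' \<longleftrightarrow> (\<forall>n. ((\<lambda>A. f A $ n) has_field_derivative f' $ n) (at 0))"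

lemma has_coeff_deriv_unique:
  "has_coeff_deriv f f' \<Longrightarrow> has_coeff_deriv f f'' \<Longrightarrow> f' = f''"
  by (auto simp: has_coeff_deriv_def fps_eq_iff intro: DERIV_unique)

lemma has_coeff_deriv_const: "has_coeff_deriv (\<lambda>_. c) 0"
  by (simp add: has_coeff_deriv_def)

lemma has_coeff_deriv_fps_const: "has_coeff_deriv fps_const 1"
  unfolding has_coeff_deriv_def
proof
  fix n show "((\<lambda>A. fps_const A $ n) has_field_derivative 1 $ n) (at (0::complex))"
    by (cases n) simp_all
qed

lemma has_coeff_deriv_add:
  "has_coeff_deriv f f' \<Longrightarrow> has_coeff_deriv h h' \<Longrightarrow> has_coeff_deriv (\<lambda>A. f A + h A) (f' + h')"
  and has_coeff_deriv_diff:
  "has_coeff_deriv f f' \<Longrightarrow> has_coeff_deriv h h' \<Longrightarrow> has_coeff_deriv (\<lambda>A. f A - h A) (f' - h')"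
  by (auto simp: has_coeff_deriv_def intro!: derivative_intros)

lemma has_coeff_deriv_mult:
  assumes "has_coeff_deriv f f'" "has_coeff_deriv h h'"
  shows "has_coeff_deriv (\<lambda>A. f A * h A) (f' * h 0 + f 0 * h')"
  unfolding has_coeff_deriv_def fps_mult_nth fps_add_nth sum.distrib[symmetric]
proof safe
  fix n
  show "((\<lambda>A. \<Sum>i=0..n. f A $ i * h A $ (n - i)) has_field_derivative
          (\<Sum>i=0..n. f' $ i * h 0 $ (n - i) + f 0 $ i * h' $ (n - i))) (at 0)"
    using assms unfolding has_coeff_deriv_def
    by (intro DERIV_sum) (auto intro!: derivative_eq_intros simp: mult_ac)
qed

lemma has_coeff_deriv_shift:
  assumes "has_coeff_deriv f f'"
  shows "has_coeff_deriv (\<lambda>A. shift c (f A)) (shift c f')"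
  using assms unfolding has_coeff_deriv_def shift_def fps_compose_nth
  by (intro allI DERIV_sum DERIV_cmult_right) auto

lemma has_coeff_deriv_fps_deriv:
  assumes "has_coeff_deriv f f'"
  shows "has_coeff_deriv (\<lambda>A. fps_deriv (f A)) (fps_deriv f')"
  using assms unfolding has_coeff_deriv_def fps_deriv_nth
  by (intro allI DERIV_cmult) auto

lemmas has_coeff_deriv_intros = has_coeff_deriv_const has_coeff_deriv_fps_const has_coeff_deriv_add
  has_coeff_deriv_diff has_coeff_deriv_mult has_coeff_deriv_shift has_coeff_deriv_fps_deriv

lemma polyfun2_differentiable:
  assumes "polyfun2 f"
  shows "(\<lambda>A. f A 0) field_differentiable (at 0)"
proof -
  obtain P :: "complex poly poly" where P: "\<And>A B. f A B = poly (poly P [:A:]) B"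
    using assms unfolding polyfun2_def by blast
  have "(\<lambda>A. poly (poly P [:A:]) 0) field_differentiable (at 0)"
    by (induction P) (auto intro!: derivative_intros)
  then show ?thesis by (simp add: P)
qed

definition dFseries :: "complex fps" where
  "dFseries = Abs_fps (\<lambda>n. deriv (\<lambda>A. Fseries A 0 $ n) 0)"

lemma Fseries_has_coeff_deriv: "has_coeff_deriv (\<lambda>A. Fseries A 0) dFseries"
  using polyfun2_differentiable[OF polyfun2_Fseries]
  by (simp add: has_coeff_deriv_def dFseries_def DERIV_deriv_iff_field_differentiable)

lemma logF_has_coeff_deriv: "has_coeff_deriv (\<lambda>A. logF A 0) (Abs_fps g)"
proof -
  have "polyfun2 (Lcoeff n)" for n
    using Lcoeff_polynomial by (simp add: polyfun2_def)
  from polyfun2_differentiable[OF this] show ?thesis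
    by (simp add: has_coeff_deriv_def g_def Lcoeff_def DERIV_deriv_iff_field_differentiable)
qed

lemma Fseries_nth_0: "Fseries A B $ 0 = 1"
  by (simp add: Fseries_def Gcoeff_def acoeff_def)

lemma logF_deriv: "fps_deriv (logF A B) * Fseries A B = fps_deriv (Fseries A B)"
proof -
  let ?h = "Fseries A B - 1"
  have h0: "?h $ 0 = 0"
    by (simp add: Fseries_nth_0)
  have "inverse (1 + fps_X) * (1 + fps_X) = (1 :: complex fps)"
    by (rule inverse_mult_eq_1) simp
  then have "((inverse (1 + fps_X) * (1 + fps_X)) oo ?h) = 1"
    by simp
  then have "(inverse (1 + fps_X) oo ?h) * Fseries A B = 1"
    by (simp add: fps_compose_mult_distrib[OF h0] fps_compose_add_distrib fps_X_fps_compose_startby0[OF h0])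
  then show ?thesis
    by (simp add: logF_def fps_compose_deriv[OF h0] fps_ln_deriv)
qed

text \<open>
  \<open>\<Sum> g\<^sub>n Z\<^sup>-\<^sup>n\<close> is the logarithmic derivative of \<open>F\<close> in \<open>A\<close>. To avoid differentiating the composition with the
  logarithm series, the equation \<open>(log F)' F = F'\<close> for the derivative in \<open>1/Z\<close> is differentiated in \<open>A\<close>; it determines
  the \<open>A\<close>-derivative of \<open>log F\<close> up to its constant term, which is \<open>0\<close>.
\<close>
lemma g_series: "Abs_fps g * Fseries 0 0 = dFseries"
proof -
  let ?G = "Abs_fps g" and ?F = "Fseries 0 0"
  have F0: "?F $ 0 = 1"
    by (rule Fseries_nth_0)
  then have nz: "?F \<noteq> 0"
    by auto
  have "has_coeff_deriv (\<lambda>A. fps_deriv (logF A 0) * Fseries A 0)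
      (fps_deriv ?G * ?F + fps_deriv (logF 0 0) * dFseries)"
    by (intro has_coeff_deriv_intros logF_has_coeff_deriv Fseries_has_coeff_deriv)
  moreover have "has_coeff_deriv (\<lambda>A. fps_deriv (Fseries A 0)) (fps_deriv dFseries)"
    by (intro has_coeff_deriv_intros Fseries_has_coeff_deriv)
  ultimately have eq: "fps_deriv ?G * ?F + fps_deriv (logF 0 0) * dFseries = fps_deriv dFseries"
    unfolding logF_deriv by (rule has_coeff_deriv_unique)
  \<comment> \<open>the expected answer, which satisfies the same equation as \<open>?G\<close>\<close>
  define D where "D = dFseries * inverse ?F"
  have inv: "inverse ?F * ?F = 1"
    by (rule inverse_mult_eq_1) (simp add: F0)
  have D: "D * ?F = dFseries"
    by (simp add: D_def mult.assoc inv)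
  have "fps_deriv ?G * ?F + fps_deriv (logF 0 0) * (D * ?F) = fps_deriv D * ?F + D * fps_deriv ?F"
    using eq unfolding D[symmetric] by (simp add: add.commute)
  then have "fps_deriv ?G * ?F = fps_deriv D * ?F"
    unfolding logF_deriv[symmetric] by (simp add: mult_ac)
  then have "fps_deriv ?G = fps_deriv D"
    using nz by (metis mult_right_cancel)
  moreover have "g 0 = 0"
    by (simp add: g_def Lcoeff_def logF_def)
  moreover have "dFseries $ 0 = 0"
    by (simp add: dFseries_def Fseries_nth_0)
  ultimately have "?G = D"
    unfolding fps_deriv_eq_iff by (simp add: D_def)
  then show ?thesis
    by (simp add: D)
qed

lemma Fseries_0_shift: "shift (- 1) (Fseries 0 0) = (1 - fps_X\<^sup>2) * shift 3 (Fseries 0 0)"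
proof -
  have "(1 + 2 * fps_X) * shift (- 1) (Fseries 0 0) = (1 + 2 * fps_X) * ((1 - fps_X\<^sup>2) * shift 3 (Fseries 0 0))"
    using Fseries_recurrence[of 0 0] by (simp add: mult_ac)
  moreover have "(1 + 2 * fps_X :: complex fps) \<noteq> 0"
    by (rule fps_nonzeroI) simp
  ultimately show ?thesis
    by (metis mult_left_cancel)
qed

lemma dFseries_shift:
  "(1 + 2 * fps_X) * (shift (- 1) dFseries - 2 * fps_X\<^sup>2 * shift (- 1) (Fseries 0 0))
   = (1 - fps_X\<^sup>2) * ((1 + 2 * fps_X) * shift 3 dFseries + 2 * fps_const \<i> * fps_X\<^sup>2 * shift 1 (Fseries 0 0))"
proof -
  let ?l = "\<lambda>A. (1 + 2 * fps_X) * (1 - 2 * fps_const A * fps_X ^ 2 + fps_const A * fps_const A * fps_X ^ 4) * shift (- 1) (Fseries A 0)"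
  let ?r = "\<lambda>A. (1 - fps_X\<^sup>2) * ((1 + 2 * fps_X) * shift 3 (Fseries A 0) + 2 * fps_const \<i> * fps_const A * fps_X\<^sup>2 * shift 1 (Fseries A 0))"
  have eq: "?l = ?r"
    using Fseries_recurrence[of _ 0] by (auto simp: power2_eq_square)
  note intros = has_coeff_deriv_intros Fseries_has_coeff_deriv
  have l: "has_coeff_deriv ?l ((1 + 2 * fps_X) * (shift (- 1) dFseries - 2 * fps_X\<^sup>2 * shift (- 1) (Fseries 0 0)))"
    by (rule back_subst[of "has_coeff_deriv ?l"], (rule intros)+) (simp add: algebra_simps)
  have r: "has_coeff_deriv ?r ((1 - fps_X\<^sup>2) * ((1 + 2 * fps_X) * shift 3 dFseries + 2 * fps_const \<i> * fps_X\<^sup>2 * shift 1 (Fseries 0 0)))"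
    by (rule back_subst[of "has_coeff_deriv ?r"], (rule intros)+) (simp add: algebra_simps)
  show ?thesis
    using has_coeff_deriv_unique[OF l r[folded eq]] .
qed

section \<open>Extension of scalars from the rationals\<close>

definition of_rat_fps :: "rat fps \<Rightarrow> complex fps" where
  "of_rat_fps f = Abs_fps (\<lambda>n. of_rat (f $ n))"

lemma of_rat_fps_nth [simp]: "of_rat_fps f $ n = of_rat (f $ n)"
  by (simp add: of_rat_fps_def)

lemma of_rat_fps_add: "of_rat_fps (f + h) = of_rat_fps f + of_rat_fps h"
  and of_rat_fps_diff: "of_rat_fps (f - h) = of_rat_fps f - of_rat_fps h"
  and of_rat_fps_minus: "of_rat_fps (- f) = - of_rat_fps f"
  and of_rat_fps_mult: "of_rat_fps (f * h) = of_rat_fps f * of_rat_fps h"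
  and of_rat_fps_const: "of_rat_fps (fps_const c) = fps_const (of_rat c)"
  and of_rat_fps_X: "of_rat_fps fps_X = fps_X"
  by (simp_all add: fps_eq_iff of_rat_add of_rat_diff of_rat_minus of_rat_mult of_rat_sum fps_mult_nth)

lemma of_rat_fps_1: "of_rat_fps 1 = 1"
  using of_rat_fps_const[of 1] by simp

lemma of_rat_fps_numeral: "of_rat_fps (numeral w) = numeral w"
  using of_rat_fps_const[of "numeral w"] by (simp add: numeral_fps_const)

lemma of_rat_fps_power: "of_rat_fps (f ^ n) = of_rat_fps f ^ n"
  by (induction n) (simp_all add: of_rat_fps_1 of_rat_fps_mult)

lemmas of_rat_fps_hom = of_rat_fps_add of_rat_fps_diff of_rat_fps_minus of_rat_fps_mult
  of_rat_fps_const of_rat_fps_X of_rat_fps_1 of_rat_fps_numeral of_rat_fps_power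

lemma of_rat_fps_compose: "of_rat_fps (f oo h) = of_rat_fps f oo of_rat_fps h"
  by (simp add: fps_eq_iff fps_compose_nth of_rat_sum of_rat_mult flip: of_rat_fps_power)

lemma of_rat_fps_recip_affine:
  assumes "a \<noteq> 0"
  shows "of_rat_fps (recip_affine a b) = recip_affine (of_rat a) (of_rat b)"
proof -
  let ?l = "fps_const (of_rat a) + fps_const (of_rat b) * fps_X :: complex fps"
  have "of_rat_fps (recip_affine a b) * ?l = fps_X"
    using arg_cong[OF recip_affine_mult[OF assms, of b], of of_rat_fps] by (simp only: of_rat_fps_hom)
  moreover have "recip_affine (of_rat a) (of_rat b) * ?l = fps_X"
    by (rule recip_affine_mult) (use assms in simp)
  ultimately show ?thesis
    by (metis fps_X_neq_zero mult_eq_0_iff mult_right_cancel)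
qed

section \<open>Comparison of the two sides\<close>

text \<open>
  The quotient \<open>y(z) = F(Z+2) / F(Z)\<close> satisfies \<open>y(z) y(z+2) = 1 / (1 - 1/z\<^sup>2)\<close>, and by the equation for \<open>rhat\<close> so does
  \<open>rhat(-z/2) / (2 (1 - 1/z))\<close>. Both have constant term \<open>1\<close>.
\<close>
lemma Fseries_0_ratio:
  defines "w \<equiv> shift (- 1) (Fseries 0 0)"
  shows "2 * (1 - fps_X) * shift 2 w = of_rat_fps rhat_half * w"
proof -
  let ?r = "of_rat_fps rhat_half"
  have w0: "w $ 0 = 1"
    by (simp add: w_def Fseries_nth_0)
  have inv: "inverse (1 - fps_X) * (1 - fps_X) = (1 :: complex fps)" "inverse w * w = 1"
    by (intro inverse_mult_eq_1; simp add: w0)+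
  \<comment> \<open>the two candidates for the quotient \<open>F(Z+2) / F(Z)\<close>\<close>
  define y y' where "y = shift 2 w * inverse w" and "y' = fps_const (1 / 2) * ?r * inverse (1 - fps_X)"
  have y: "y * w = shift 2 w" and y': "y' * (2 * (1 - fps_X)) = ?r"
    using inv by (simp_all add: y_def y'_def mult_ac numeral_fps_const)
  have "w = (1 - fps_X\<^sup>2) * shift 4 w"
    unfolding w_def shift_shift using Fseries_0_shift by simp
  also have "shift 4 w = shift 2 (y * w)"
    unfolding y by (simp add: shift_shift)
  also have "\<dots> = shift 2 y * (y * w)"
    by (simp only: shift_mult y[symmetric])
  finally have "1 * w = ((1 - fps_X\<^sup>2) * (y * shift 2 y)) * w"
    by (simp add: mult_ac)
  then have 1: "(1 - fps_X\<^sup>2) * (y * shift 2 y) = 1"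
    using w0 by (metis fps_zero_nth mult_right_cancel zero_neq_one)
  have r2: "recip_affine 1 2 * (1 + 2 * fps_X) = (fps_X :: complex fps)"
    using recip_affine_1_mult[of "2::complex"] by (simp add: numeral_fps_const)
  have "(1 + 2 * fps_X) * (?r * shift 2 ?r) = 4"
    using arg_cong[OF rhat_half_mult_shift, of of_rat_fps]
    by (simp add: of_rat_fps_hom shift_def of_rat_fps_compose of_rat_fps_recip_affine)
  moreover have y'_shift: "shift 2 y' * (2 * (1 - recip_affine 1 2)) = shift 2 ?r"
    using arg_cong[OF y', of "shift 2"] by (simp only: shift_hom)
  ultimately have "4 = (1 + 2 * fps_X) * (y' * (2 * (1 - fps_X)) * (shift 2 y' * (2 * (1 - recip_affine 1 2))))"
    unfolding y' y'_shift by simp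
  also have "\<dots> = 4 * ((1 - fps_X) * ((1 + 2 * fps_X) - recip_affine 1 2 * (1 + 2 * fps_X)) * (y' * shift 2 y'))"
    by (simp add: algebra_simps)
  also have "\<dots> = 4 * ((1 - fps_X\<^sup>2) * (y' * shift 2 y'))"
    unfolding r2 by (simp add: algebra_simps power2_eq_square)
  finally have 2: "(1 - fps_X\<^sup>2) * (y' * shift 2 y') = 1"
    by (simp add: numeral_fps_const)
  have "(1 - fps_X\<^sup>2 :: complex fps) \<noteq> 0"
    by (rule fps_nonzeroI) simp
  then have "y * shift 2 y = y' * shift 2 y'"
    using 1 2 by (metis mult_left_cancel)
  then have "y = y'"
    by (rule fps_mult_shift_unique) (simp_all add: y_def y'_def w0 rhat_half_def rhat_nth_0)
  then have "2 * (1 - fps_X) * shift 2 w = (y' * (2 * (1 - fps_X))) * w"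
    unfolding y[symmetric] by (simp only: mult_ac)
  then show ?thesis
    unfolding y' .
qed

text \<open>
  The recurrence at first order in \<open>A\<close>, divided by the recurrence at \<open>A = 0\<close>; the term with \<open>F(Z+2)\<close> is expressed by
  \<open>rhat\<close>.
\<close>
lemma g_series_shift:
  defines "h \<equiv> shift (- 1) (Abs_fps g)"
  shows "(1 + 2 * fps_X) * (shift 4 h - h)
    = - (2 * fps_X\<^sup>2 * (1 + 2 * fps_X)) - fps_const \<i> * (fps_X\<^sup>2 * (1 + fps_X) * of_rat_fps rhat_half)"
proof -
  define w where "w = shift (- 1) (Fseries 0 0)"
  have w0: "w $ 0 = 1"
    by (simp add: w_def Fseries_nth_0)
  have w: "w = (1 - fps_X\<^sup>2) * shift 4 w"
    unfolding w_def shift_shift using Fseries_0_shift by simp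
  have d: "shift (- 1) dFseries = h * w" "shift 3 dFseries = shift 4 h * shift 4 w" "shift 1 (Fseries 0 0) = shift 2 w"
    by (simp_all add: h_def w_def shift_shift shift_mult flip: g_series)
  have "(1 + 2 * fps_X) * (h * w - 2 * fps_X\<^sup>2 * w)
      = (1 + 2 * fps_X) * (shift 4 h * ((1 - fps_X\<^sup>2) * shift 4 w))
        + fps_const \<i> * (fps_X\<^sup>2 * (1 + fps_X) * (2 * (1 - fps_X) * shift 2 w))"
    using dFseries_shift unfolding d w_def[symmetric] by (simp add: algebra_simps power2_eq_square)
  also have "\<dots> = (1 + 2 * fps_X) * (shift 4 h * w)
        + fps_const \<i> * (fps_X\<^sup>2 * (1 + fps_X) * (of_rat_fps rhat_half * w))"
    unfolding w[symmetric] Fseries_0_ratio[folded w_def] ..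
  finally have "((1 + 2 * fps_X) * (shift 4 h - h)) * w
    = (- (2 * fps_X\<^sup>2 * (1 + 2 * fps_X)) - fps_const \<i> * (fps_X\<^sup>2 * (1 + fps_X) * of_rat_fps rhat_half)) * w"
    by (simp add: algebra_simps)
  then show ?thesis
    using w0 by (metis fps_zero_nth mult_right_cancel zero_neq_one)
qed

text \<open>Both sides have constant term \<open>0\<close> and satisfy the same difference equation of step \<open>4\<close>.\<close>
lemma g_series_eq: "Abs_fps g = trigamma_part - fps_const (\<i> / 2) * of_rat_fps Qhat_Z"
proof -
  define K where "K = trigamma_part - fps_const (\<i> / 2) * of_rat_fps Qhat_Z"
  define D where "D = Abs_fps g - K"
  define q where "q = of_rat_fps (shift (- 1) Qhat_Z)"
  have q: "q = shift (- 1) (of_rat_fps Qhat_Z)" "shift 4 q = of_rat_fps (shift 4 (shift (- 1) Qhat_Z))"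
    by (simp_all add: q_def shift_def of_rat_fps_compose of_rat_fps_recip_affine of_rat_minus)
  have Q: "(1 + 2 * fps_X) * (shift 4 q - q) = 2 * fps_X\<^sup>2 * (1 + fps_X) * of_rat_fps rhat_half"
    using arg_cong[OF Qhat_Z_shift, of of_rat_fps] unfolding q(2) by (simp only: of_rat_fps_hom q_def)
  have t: "shift 4 (shift (- 1) trigamma_part) = shift (- 1) trigamma_part - 2 * fps_X\<^sup>2"
    using arg_cong[OF trigamma_part_shift, of "shift (- 1)"]
    by (simp add: shift_hom shift_shift shift_recip_affine recip_affine_1_0)
  have i: "fps_const (\<i> / 2) * 2 = fps_const \<i>"
    by (simp add: numeral_fps_const)
  define k where "k = shift (- 1) K"
  have k: "k = shift (- 1) trigamma_part - fps_const (\<i> / 2) * q"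
    by (simp add: k_def K_def q shift_hom)
  have "(1 + 2 * fps_X) * (shift 4 k - k)
      = - (2 * fps_X\<^sup>2 * (1 + 2 * fps_X)) - fps_const (\<i> / 2) * ((1 + 2 * fps_X) * (shift 4 q - q))"
    unfolding k shift_diff shift_mult shift_const t by (simp add: algebra_simps)
  also have "\<dots> = - (2 * fps_X\<^sup>2 * (1 + 2 * fps_X)) - fps_const \<i> * (fps_X\<^sup>2 * (1 + fps_X) * of_rat_fps rhat_half)"
    unfolding Q i[symmetric] by (simp only: mult.assoc)
  finally have "(1 + 2 * fps_X) * (shift 4 (shift (- 1) (Abs_fps g)) - shift (- 1) (Abs_fps g)) = (1 + 2 * fps_X) * (shift 4 k - k)"
    using g_series_shift by simp
  moreover have "(1 + 2 * fps_X :: complex fps) \<noteq> 0"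
    by (rule fps_nonzeroI) simp
  ultimately have "shift 4 (shift (- 1) (Abs_fps g)) - shift (- 1) (Abs_fps g) = shift 4 k - k"
    by (metis mult_left_cancel)
  then have "shift 4 (shift (- 1) D) = shift (- 1) D"
    by (simp add: D_def k_def shift_diff algebra_simps)
  then have "shift (- 1) D = 0"
    by (rule shift_eq_self_imp_0)
       (simp_all add: D_def K_def trigamma_part_def trigamma_series_def Qhat_Z_def Qhat_nth_0 g_def Lcoeff_def logF_def)
  then have "shift 1 (shift (- 1) D) = 0"
    by (simp add: shift_def)
  then show ?thesis
    by (simp add: shift_shift shift_0 D_def K_def)
qed

lemma of_rat_complex: "(of_rat x :: complex) = of_real (of_rat x)"
  by (cases x) (simp add: of_rat_rat)

text \<open>
  The difference equation of the trigamma part has rational coefficients, so the series of imaginary parts is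
  invariant under the shift by \<open>4\<close>.
\<close>
lemma Im_trigamma_part: "Im (trigamma_part $ n) = 0"
proof -
  define D where "D = Abs_fps (\<lambda>n. complex_of_real (Im (trigamma_part $ n)))"
  have ra: "recip_affine 1 (of_rat c) = of_rat_fps (recip_affine 1 c)" for c
    by (simp add: of_rat_fps_recip_affine)
  have "shift 4 D = D"
  proof (rule fps_ext)
    fix m
    define r :: "nat \<Rightarrow> real" where "r i = of_rat ((recip_affine 1 4 ^ i) $ m)" for i
    have r: "(recip_affine 1 4 ^ i) $ m = complex_of_real (r i)" for i
      using arg_cong[OF ra[of 4], of "\<lambda>f. (f ^ i) $ m"]
      by (simp add: r_def flip: of_rat_complex of_rat_fps_power)
    have shift4: "shift 4 f $ m = (\<Sum>i=0..m. f $ i * of_real (r i))" for f :: "complex fps"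
      by (simp add: shift_def fps_compose_nth r)
    have "shift 4 D $ m = of_real (\<Sum>i=0..m. Im (trigamma_part $ i) * r i)"
      unfolding shift4 by (simp add: D_def)
    also have "(\<Sum>i=0..m. Im (trigamma_part $ i) * r i) = Im (shift 4 trigamma_part $ m)"
      unfolding shift4 by simp
    also have "\<dots> = Im (trigamma_part $ m)"
    proof -
      have "2 * (recip_affine 1 1)\<^sup>2 = of_rat_fps (2 * (recip_affine 1 1)\<^sup>2)"
        by (simp add: of_rat_fps_hom of_rat_fps_recip_affine)
      then have "Im ((2 * (recip_affine 1 1)\<^sup>2) $ m) = 0"
        by (simp add: of_rat_complex)
      then show ?thesis
        unfolding trigamma_part_shift by simp
    qed
    finally show "shift 4 D $ m = D $ m"
      by (simp add: D_def)
  qed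
  then have "D = 0"
    by (rule shift_eq_self_imp_0) (simp_all add: D_def trigamma_part_def trigamma_series_def)
  then have "D $ n = 0"
    by simp
  then show ?thesis
    by (simp add: D_def)
qed

theorem theorem7p35:
  shows "Abs_fps (\<lambda>n. if n = 0 then 0 else g n) =
           fps_const (1 / 16) * (trigamma_series oo recip_affine (1 / 4) (1 / 4))
         - fps_const (1 / 16) * (trigamma_series oo recip_affine (1 / 4) (3 / 4))
         + fps_const (1 / 4) * (trigamma_series oo recip_affine (1 / 2) (1 / 2))
         - fps_const (\<i> / 2) * Abs_fps (\<lambda>n. of_rat (fps_nth Qhat_Z n))
         \<and> (\<forall>n\<ge>1. Im (g n) = - (1 / 2) * of_rat (fps_nth Qhat_Z n))"
proof (intro conjI allI impI)
  have "g 0 = 0"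
    by (simp add: g_def Lcoeff_def logF_def)
  then have "Abs_fps (\<lambda>n. if n = 0 then 0 else g n) = Abs_fps g"
    by (simp add: fps_eq_iff)
  then show "Abs_fps (\<lambda>n. if n = 0 then 0 else g n) =
           fps_const (1 / 16) * (trigamma_series oo recip_affine (1 / 4) (1 / 4))
         - fps_const (1 / 16) * (trigamma_series oo recip_affine (1 / 4) (3 / 4))
         + fps_const (1 / 4) * (trigamma_series oo recip_affine (1 / 2) (1 / 2))
         - fps_const (\<i> / 2) * Abs_fps (\<lambda>n. of_rat (fps_nth Qhat_Z n))"
    by (simp add: g_series_eq trigamma_part_def of_rat_fps_def)
next
  fix n
  have "g n = trigamma_part $ n - \<i> / 2 * of_rat (Qhat_Z $ n)"
    using arg_cong[OF g_series_eq, of "\<lambda>f. f $ n"] by simp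
  moreover have "of_rat (Qhat_Z $ n) = complex_of_real (of_rat (Qhat_Z $ n))"
    by (rule of_rat_complex)
  ultimately show "Im (g n) = - (1 / 2) * of_rat (fps_nth Qhat_Z n)"
    by (simp add: Im_trigamma_part)
qed

end
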